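(* Let $\mathbb X$ and $\mathbb Y$ be minimal, aperiodic flow spaces with expansions $(X_i,f_i,p_i)$ of $\mathbb X$ and $(X_i,g_i,q_i)$ of $\mathbb Y$ using the same oriented wedges $X_i$ (with wedge points $x_i$). Suppose that for every $i$ there is $a_i\in\pi_1(X_i,x_i)$ with $\pi_1(g_i)=\mathbf c_{a_i}\pi_1(f_i)$. Then $\mathbb X$ and $\mathbb Y$ are flow equivalent.
   Context: Flow space: compact metrizable space of topological dimension one with continuous $\mathbb R$-action without fixed points; minimal: all orbits dense; aperiodic: no periodic orbit; flow equivalence: homeomorphism mapping orbits to orbits preserving flow orientation. Expansion of $\mathbb X$ about a point $x_\bullet$: oriented wedges of circles $X_i$ with wedge points $x_i$, positive maps $f_i\colon X_{i+1}\to X_i$ (continuous surjections, wedge point to wedge point, orientation preserving on each circle, locally injective away from the wedge point), projections $p_i\colon\mathbb X\to X_i$ (continuous surjections, locally injective and orientation preserving along orbits) with $p_i(x_\bullet)=x_i$, $p_n=f_n\circ\cdots\circ f_{m-1}\circ p_m$, and $x\mapsto(p_i(x))_i$ a homeomorphism onto $\varprojlim(X_i,f_i)$. $\pi_1(f_i)\colon\pi_1(X_{i+1},x_{i+1})\to\pi_1(X_i,x_i)$ is the induced homomorphism, and $\mathbf c_ah(x)=a^{-1}h(x)a$. *)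

theory Defs
  imports "HOL-Analysis.Analysis"
begin

definition covering_dim_le :: "'a topology \<Rightarrow> nat \<Rightarrow> bool" where
  "covering_dim_le X n \<longleftrightarrow>
     (\<forall>\<U>. finite \<U> \<and> (\<forall>U\<in>\<U>. openin X U) \<and> \<Union>\<U> = topspace X \<longrightarrow>
        (\<exists>\<V>. finite \<V> \<and> (\<forall>V\<in>\<V>. openin X V) \<and> \<Union>\<V> = topspace X \<and>
              (\<forall>V\<in>\<V>. \<exists>U\<in>\<U>. V \<subseteq> U) \<and>
              (\<forall>x\<in>topspace X. card {V\<in>\<V>. x \<in> V} \<le> n + 1)))"

definition topological_dimension_one :: "'a topology \<Rightarrow> bool" where
  "topological_dimension_one X \<longleftrightarrow> covering_dim_le X 1 \<and> \<not> covering_dim_le X 0"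

definition flow_space :: "'a topology \<Rightarrow> (real \<Rightarrow> 'a \<Rightarrow> 'a) \<Rightarrow> bool" where
  "flow_space X \<phi> \<longleftrightarrow>
     compact_space X \<and> metrizable_space X \<and> topological_dimension_one X \<and>
     continuous_map (prod_topology euclideanreal X) X (\<lambda>(t, x). \<phi> t x) \<and>
     (\<forall>x\<in>topspace X. \<phi> 0 x = x) \<and>
     (\<forall>s t. \<forall>x\<in>topspace X. \<phi> (s + t) x = \<phi> s (\<phi> t x)) \<and>
     (\<forall>x\<in>topspace X. \<exists>t. \<phi> t x \<noteq> x)"

definition orbit :: "(real \<Rightarrow> 'a \<Rightarrow> 'a) \<Rightarrow> 'a \<Rightarrow> 'a set" where
  "orbit \<phi> x = range (\<lambda>t. \<phi> t x)"

definition minimal_flow :: "'a topology \<Rightarrow> (real \<Rightarrow> 'a \<Rightarrow> 'a) \<Rightarrow> bool" where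
  "minimal_flow X \<phi> \<longleftrightarrow> (\<forall>x\<in>topspace X. X closure_of (orbit \<phi> x) = topspace X)"

definition aperiodic_flow :: "'a topology \<Rightarrow> (real \<Rightarrow> 'a \<Rightarrow> 'a) \<Rightarrow> bool" where
  "aperiodic_flow X \<phi> \<longleftrightarrow> (\<forall>x\<in>topspace X. \<forall>t. t \<noteq> 0 \<longrightarrow> \<phi> t x \<noteq> x)"

definition flow_equivalent ::
  "'a topology \<Rightarrow> (real \<Rightarrow> 'a \<Rightarrow> 'a) \<Rightarrow> 'b topology \<Rightarrow> (real \<Rightarrow> 'b \<Rightarrow> 'b) \<Rightarrow> bool" where
  "flow_equivalent X \<phi> Y \<psi> \<longleftrightarrow>
     (\<exists>h. homeomorphic_map X Y h \<and>
          (\<forall>x\<in>topspace X. h ` orbit \<phi> x = orbit \<psi> (h x) \<and>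
             (\<exists>\<tau>. continuous_on UNIV \<tau> \<and> strict_mono \<tau> \<and>
                   (\<forall>t. h (\<phi> t x) = \<psi> (\<tau> t) (h x)))))"

text \<open>Standard model of the oriented wedge of k circles in the complex plane:
circle j (1 \<le> j \<le> k) is |z - j| = j, parametrised counterclockwise by
s \<mapsto> j(1 - e^{is}); all circles meet only in the wedge point 0.\<close>
definition circ :: "nat \<Rightarrow> real \<Rightarrow> complex" where
  "circ j s = of_nat j * (1 - exp (\<i> * of_real s))"

definition wedge :: "nat \<Rightarrow> complex set" where
  "wedge k = (\<lambda>(j, s). circ j s) ` ({1..k} \<times> UNIV)"

text \<open>A curve \<gamma> in the wedge of k circles is locally injective and orientation
preserving at time t: near t it runs positively along the circles (through the
wedge point it may pass from one circle to another).\<close>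
definition positive_at :: "nat \<Rightarrow> (real \<Rightarrow> complex) \<Rightarrow> real \<Rightarrow> bool" where
  "positive_at k \<gamma> t \<longleftrightarrow>
     (\<exists>\<delta>>0. \<exists>j\<in>{1..k}. \<exists>j'\<in>{1..k}. \<exists>\<sigma>.
        continuous_on {t - \<delta>..t + \<delta>} \<sigma> \<and> strict_mono_on {t - \<delta>..t + \<delta>} \<sigma> \<and>
        (\<forall>u\<in>{t - \<delta>..t}. \<gamma> u = circ j (\<sigma> u)) \<and>
        (\<forall>u\<in>{t..t + \<delta>}. \<gamma> u = circ j' (\<sigma> u)))"

definition positive_map :: "nat \<Rightarrow> nat \<Rightarrow> (complex \<Rightarrow> complex) \<Rightarrow> bool" where
  "positive_map k k' f \<longleftrightarrow>
     continuous_on (wedge k) f \<and> f ` wedge k = wedge k' \<and> f 0 = 0 \<and>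
     (\<forall>j\<in>{1..k}. \<forall>s. positive_at k' (\<lambda>s. f (circ j s)) s)"

definition inv_limit :: "(nat \<Rightarrow> nat) \<Rightarrow> (nat \<Rightarrow> complex \<Rightarrow> complex) \<Rightarrow> (nat \<Rightarrow> complex) set" where
  "inv_limit k f = {s. \<forall>i. s i \<in> wedge (k i) \<and> s i = f i (s (Suc i))}"

definition expansion ::
  "'a topology \<Rightarrow> (real \<Rightarrow> 'a \<Rightarrow> 'a) \<Rightarrow> 'a \<Rightarrow> (nat \<Rightarrow> nat) \<Rightarrow>
   (nat \<Rightarrow> complex \<Rightarrow> complex) \<Rightarrow> (nat \<Rightarrow> 'a \<Rightarrow> complex) \<Rightarrow> bool" where
  "expansion X \<phi> x0 k f p \<longleftrightarrow>
     x0 \<in> topspace X \<and> (\<forall>i. 1 \<le> k i) \<and>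
     (\<forall>i. positive_map (k (Suc i)) (k i) (f i)) \<and>
     (\<forall>i. continuous_map X (top_of_set (wedge (k i))) (p i) \<and>
          p i ` topspace X = wedge (k i) \<and>
          (\<forall>x\<in>topspace X. \<forall>t. positive_at (k i) (\<lambda>t. p i (\<phi> t x)) t) \<and>
          p i x0 = 0) \<and>
     (\<forall>i. \<forall>x\<in>topspace X. p i x = f i (p (Suc i) x)) \<and>
     homeomorphic_map X
       (subtopology (product_topology (\<lambda>i. top_of_set (wedge (k i))) UNIV) (inv_limit k f))
       (\<lambda>x i. p i x)"

definition loop_at :: "complex set \<Rightarrow> complex \<Rightarrow> (real \<Rightarrow> complex) \<Rightarrow> bool" where
  "loop_at S b \<gamma> \<longleftrightarrow> path \<gamma> \<and> path_image \<gamma> \<subseteq> S \<and> pathstart \<gamma> = b \<and> pathfinish \<gamma> = b"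

text \<open>pi_1(g) = c_a pi_1(f) for a = [\<alpha>] in pi_1(S, b), where the homomorphisms are
induced by f, g : (T, b') \<rightarrow> (S, b): for every loop \<gamma> at b' in T,
[g \<circ> \<gamma>] = [\<alpha>]^-1 [f \<circ> \<gamma>] [\<alpha>].\<close>
definition pi1_conj_by :: "complex set \<Rightarrow> complex \<Rightarrow> complex set \<Rightarrow> complex \<Rightarrow>
    (real \<Rightarrow> complex) \<Rightarrow> (complex \<Rightarrow> complex) \<Rightarrow> (complex \<Rightarrow> complex) \<Rightarrow> bool" where
  "pi1_conj_by S b T b' \<alpha> g f \<longleftrightarrow>
     loop_at S b \<alpha> \<and>
     (\<forall>\<gamma>. loop_at T b' \<gamma> \<longrightarrow>
        homotopic_paths S (g \<circ> \<gamma>) (reversepath \<alpha> +++ ((f \<circ> \<gamma>) +++ \<alpha>)))"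

end

theory Submission
  imports Defs
begin

text \<open>Composing a curve in a wedge with the continuous map sending every circle onto the unit circle
gives it a phase; a positive curve has a strictly increasing phase lift and is determined by that lift
together with the bi-infinite word of circles it traverses. If the induced homomorphisms satisfy
a G = F a in the free group, then for a positive curve the words read by its images under f and g agree
up to a shift which depends only on a, because free cancellation only affects boundedly many letters
near the ends. Hence every orbit can be slid along itself by a continuous displacement that turns the
f-image into the g-image at the level below. Composing these displacements over the first i levels
gives, for each i, a map of the first flow to itself along orbits, and reading the i-th coordinate
after the i-th displacement defines a point of the second inverse limit. The displacements may diverge
as i grows, but only the compatibility of the coordinates matters, so no convergence is needed.\<close>

section \<open>Phases and positive curves\<close>

text \<open>Two obstacles shape the proof. The correction between consecutive levels must not depend
  on the loop or orbit used to find it, and orbits and injectivity must be controlled although the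
  accumulated displacements may diverge. For the former, free words come from sampling a path finely
  and recording passages through the antipodes of the wedge point. The path \<alpha> is sampled at a
  mesh fixed before any loop, so the number of disturbed letters and the shift, which is the
  exponent sum of the word of \<alpha>, are uniform. Conjugation preserves exponent sums, so lifted
  phases of the f- and g-images differ by a continuous function on the wedge, and the displacement
  is the root of a monotone equation along the orbit. For the latter, level 0 is never displaced and
  serves as a clock on both sides. Orbits go to orbits because preimages of countable sets under
  positive maps are countable, and injectivity follows by undoing displacements one at a time on
  whole itineraries. Minimality of the second flow gives surjectivity.\<close>

definition phase :: "complex \<Rightarrow> complex" where
  "phase z = (if z = 0 then 1 else - (sgn z)\<^sup>2)"

text \<open>Solves \<open>|z - j| = j\<close> for \<open>j\<close>; the junk value at the wedge point is 0.\<close>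

definition letter :: "complex \<Rightarrow> real" where
  "letter z = (cmod z)\<^sup>2 / (2 * Re z)"

lemma circ_cis: "circ j s = of_nat j * (1 - cis s)"
  by (simp add: circ_def cis_conv_exp)

lemma Re_circ: "Re (circ j s) = real j * (1 - cos s)"
  and Im_circ: "Im (circ j s) = - real j * sin s"
  by (simp_all add: circ_cis)

lemma norm_circ: "(cmod (circ j s))\<^sup>2 = 2 * real j * Re (circ j s)"
proof -
  have "(cmod (circ j s))\<^sup>2 = (real j)\<^sup>2 * ((1 - cos s)\<^sup>2 + (sin s)\<^sup>2)"
    by (simp add: cmod_power2 Re_circ Im_circ power_mult_distrib distrib_left)
  also have "(1 - cos s)\<^sup>2 + (sin s)\<^sup>2 = 2 * (1 - cos s)"
    by (simp add: power2_diff sin_squared_eq)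
  finally show ?thesis by (simp add: Re_circ power2_eq_square)
qed

lemma circ_eq_0_iff: "circ j s = 0 \<longleftrightarrow> j = 0 \<or> cis s = 1"
  by (auto simp: circ_cis)

lemma circ_0 [simp]: "circ j 0 = 0"
  by (simp add: circ_eq_0_iff)

lemma cis_eq_iff: "cis a = cis b \<longleftrightarrow> (\<exists>n::int. a = b + 2 * pi * of_int n)"
proof -
  have "cis a = cis b \<longleftrightarrow> sin a = sin b \<and> cos a = cos b" by (auto simp: complex_eq_iff)
  then show ?thesis by (simp only: sin_cos_eq_iff)
qed

lemma cis_eq_1_iff: "cis a = 1 \<longleftrightarrow> (\<exists>n::int. a = 2 * pi * of_int n)"
  using cis_eq_iff[of a 0] by simp

lemma circ_cong: "cis s = cis s' \<Longrightarrow> circ j s = circ j s'"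
  by (simp add: circ_cis)

lemma letter_circ: "circ j s \<noteq> 0 \<Longrightarrow> letter (circ j s) = real j"
proof -
  assume a: "circ j s \<noteq> 0"
  then have "(cmod (circ j s))\<^sup>2 \<noteq> 0" by simp
  then have "Re (circ j s) \<noteq> 0" using norm_circ[of j s] by auto
  then show ?thesis by (simp add: letter_def norm_circ)
qed

text \<open>Since \<open>1 - cis s\<close> is -2i sin(s/2) e^{is/2}, the square of its direction is
  \<open>- cis s\<close>, whatever the radius. One formula thus recovers the parameter modulo 2 pi
  on all circles at once, and the value 1 at the wedge point is the common limit.\<close>

lemma phase_circ: assumes "1 \<le> j" shows "phase (circ j s) = cis s"
proof (cases "circ j s = 0")
  case True
  then show ?thesis using assms by (auto simp: phase_def circ_eq_0_iff)
next
  case False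
  let ?c = "cis s"
  have c: "?c * cnj ?c = 1" by (simp add: cis_cnj cis_mult)
  have n: "complex_of_real (cmod (circ j s)) ^ 2 = (of_nat j)\<^sup>2 * ((1 - ?c) * (1 - cnj ?c))"
  proof -
    have "complex_of_real (cmod (circ j s)) ^ 2 = circ j s * cnj (circ j s)"
      by (metis complex_norm_square of_real_power)
    also have "\<dots> = (of_nat j)\<^sup>2 * ((1 - ?c) * (1 - cnj ?c))"
      by (simp add: circ_cis power2_eq_square algebra_simps)
    finally show ?thesis .
  qed
  have nz: "complex_of_real (cmod (circ j s)) ^ 2 \<noteq> 0" using False by simp
  have "- (sgn (circ j s))\<^sup>2 = - (circ j s)\<^sup>2 / complex_of_real (cmod (circ j s)) ^ 2"
    by (simp add: sgn_eq power_divide)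
  also have "\<dots> = ?c"
  proof -
    have "?c * ((1 - ?c) * (1 - cnj ?c)) = - (1 - ?c)\<^sup>2"
      using c by (simp add: power2_eq_square algebra_simps)
    then have "(of_nat j)\<^sup>2 * (?c * ((1 - ?c) * (1 - cnj ?c))) = (of_nat j)\<^sup>2 * - (1 - ?c)\<^sup>2"
      by simp
    then have "?c * complex_of_real (cmod (circ j s)) ^ 2 = - (circ j s)\<^sup>2"
      unfolding n by (simp only: circ_cis power_mult_distrib mult_ac minus_mult_right)
    then show ?thesis using nz by (metis nonzero_eq_divide_eq)
  qed
  finally show ?thesis using False by (simp add: phase_def)
qed

lemma wedge_iff: "z \<in> wedge k \<longleftrightarrow> (\<exists>j\<in>{1..k}. \<exists>s. z = circ j s)"
  by (auto simp: wedge_def)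

lemma circ_in_wedge: "j \<in> {1..k} \<Longrightarrow> circ j s \<in> wedge k"
  by (auto simp: wedge_iff)

lemma phase_0 [simp]: "phase 0 = 1" by (simp add: phase_def)

lemma norm_phase [simp]: "norm (phase z) = 1"
  by (simp add: phase_def norm_power norm_sgn)

text \<open>Every radius is at least 1. The bound yields continuity of \<open>phase\<close> at the
  wedge point, where the generic formula breaks down.\<close>

lemma phase_near_1: assumes "z \<in> wedge k" shows "norm (phase z - 1) \<le> norm z"
proof -
  obtain j s where js: "1 \<le> j" "z = circ j s" using assms by (auto simp: wedge_iff)
  have "norm z = real j * norm (1 - cis s)" by (simp add: js circ_cis norm_mult)
  moreover have "1 * norm (1 - cis s) \<le> real j * norm (1 - cis s)"
    using js by (intro mult_right_mono) auto
  ultimately show ?thesis using js by (simp add: phase_circ norm_minus_commute)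
qed

lemma continuous_on_phase: "continuous_on (wedge k) phase"
  unfolding continuous_on_eq_continuous_within
proof
  fix z assume z: "z \<in> wedge k"
  show "continuous (at z within wedge k) phase"
  proof (cases "z = 0")
    case True
    have "(phase \<longlongrightarrow> 1) (at z within wedge k)"
      unfolding tendsto_iff dist_norm eventually_at
      using phase_near_1[of _ k] True by (force intro: le_less_trans)
    then show ?thesis using True by (simp add: continuous_within)
  next
    case False
    have "isCont (\<lambda>z. - (z / of_real (norm z))\<^sup>2) z"
      using False by (intro continuous_intros) auto
    moreover have "\<forall>\<^sub>F w in nhds z. phase w = - (w / of_real (norm w))\<^sup>2"
      using t1_space_nhds[OF False] by eventually_elim (simp add: phase_def sgn_eq)
    ultimately have "isCont phase z" by (simp add: isCont_cong)
    then show ?thesis by (rule continuous_at_imp_continuous_at_within)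
  qed
qed

text \<open>Only the choice of a circle is left open once the phase is known, so a curve amounts to
  a real lift together with discrete choices.\<close>

lemma wedge_point_eq:
  assumes "z \<in> wedge k" "phase z = cis t"
  shows "\<exists>j\<in>{1..k}. z = circ j t"
proof -
  obtain j s where js: "j \<in> {1..k}" "z = circ j s" using assms(1) by (auto simp: wedge_iff)
  then have "cis s = cis t" using assms(2) phase_circ[of j s] by simp
  then show ?thesis using js circ_cong by blast
qed

lemma continuous_on_circ: "continuous_on S (circ j)"
  unfolding circ_def by (intro continuous_intros)

text \<open>The hypothesis compares nearby values with \<open>\<theta> t\<close> only, not with each
  other. The supremum of the points up to which \<theta> stays above \<open>\<theta> a\<close> makes
  the inequality global.\<close>

lemma locally_increasing_imp_strict_mono:
  fixes \<theta> :: "real \<Rightarrow> real"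
  assumes "\<And>t. \<exists>\<delta>>0. \<forall>u. (t - \<delta> < u \<and> u < t \<longrightarrow> \<theta> u < \<theta> t) \<and> (t < u \<and> u < t + \<delta> \<longrightarrow> \<theta> t < \<theta> u)"
  shows "strict_mono \<theta>"
proof (rule strict_monoI)
  fix a b :: real assume ab: "a < b"
  define S where "S = {x. a < x \<and> x \<le> b \<and> (\<forall>y. a < y \<and> y \<le> x \<longrightarrow> \<theta> a < \<theta> y)}"
  obtain \<delta>a where da: "\<delta>a > 0" "\<And>u. a < u \<Longrightarrow> u < a + \<delta>a \<Longrightarrow> \<theta> a < \<theta> u"
    using assms[of a] by blast
  have ne: "min b (a + \<delta>a/2) \<in> S" unfolding S_def
  proof safe
    fix y assume "a < y" "y \<le> min b (a + \<delta>a/2)"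
    then show "\<theta> a < \<theta> y" using da by auto
  qed (use da ab in auto)
  have bd: "bdd_above S" by (rule bdd_aboveI[of _ b]) (auto simp: S_def)
  define m where "m = Sup S"
  have am: "a < m"
  proof -
    have "min b (a + \<delta>a/2) \<le> m" unfolding m_def using ne bd by (rule cSup_upper)
    then show ?thesis using da ab by linarith
  qed
  have mb: "m \<le> b" unfolding m_def
  proof (rule cSup_least)
    show "S \<noteq> {}" using ne by blast
  qed (auto simp: S_def)
  have below: "\<theta> a < \<theta> y" if "a < y" "y < m" for y
  proof -
    have "\<exists>x\<in>S. y < x" using that(2) ne bd less_cSup_iff[of S y] unfolding m_def by blast
    then obtain x where "x \<in> S" "y < x" by blast
    then show ?thesis using that by (auto simp: S_def)
  qed
  obtain \<delta> where d: "\<delta> > 0" "\<And>u. m - \<delta> < u \<Longrightarrow> u < m \<Longrightarrow> \<theta> u < \<theta> m"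
    "\<And>u. m < u \<Longrightarrow> u < m + \<delta> \<Longrightarrow> \<theta> m < \<theta> u" using assms[of m] by blast
  have "\<theta> a < \<theta> m"
  proof -
    define y where "y = max ((a + m)/2) (m - \<delta>/2)"
    have "a < (a + m)/2" "(a + m)/2 < m" using am by simp_all
    then have "a < y" "y < m" "m - \<delta> < y" using d(1) unfolding y_def by linarith+
    then show ?thesis using below d by (meson order.strict_trans)
  qed
  moreover have "m = b"
  proof (rule ccontr)
    assume "m \<noteq> b"
    then have "m < b" using mb by simp
    have "min b (m + \<delta>/2) \<in> S"
      unfolding S_def
    proof (safe)
      fix y assume y: "a < y" "y \<le> min b (m + \<delta>/2)"
      consider "y < m" | "y = m" | "m < y" by linarith
      then show "\<theta> a < \<theta> y"
      proof cases
        case 3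
        then have "\<theta> m < \<theta> y" using d y by auto
        with \<open>\<theta> a < \<theta> m\<close> show ?thesis by simp
      qed (use below y \<open>\<theta> a < \<theta> m\<close> in auto)
    qed (use am \<open>m < b\<close> d in auto)
    then have "min b (m + \<delta>/2) \<le> m" unfolding m_def using bd by (intro cSup_upper) auto
    then show False using \<open>m < b\<close> d by linarith
  qed
  ultimately show "\<theta> a < \<theta> b" by simp
qed

lemma continuous_Ints_constant:
  fixes f :: "'a::topological_space \<Rightarrow> real"
  assumes "connected S" "continuous_on S f" "\<And>x. x \<in> S \<Longrightarrow> f x \<in> \<int>"
  shows "f constant_on S"
proof (rule continuous_discrete_range_constant[OF assms(1,2)])
  fix x assume x: "x \<in> S"
  show "\<exists>e>0. \<forall>y. y \<in> S \<and> f y \<noteq> f x \<longrightarrow> e \<le> norm (f y - f x)"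
  proof (intro exI[of _ 1] conjI allI impI)
    fix y assume "y \<in> S \<and> f y \<noteq> f x"
    then have "f y - f x \<in> \<int>" "f y - f x \<noteq> 0" using x assms(3) by (auto intro: Ints_diff)
    then show "1 \<le> norm (f y - f x)" by (simp add: Ints_nonzero_abs_ge1)
  qed simp
qed

text \<open>The difference divided by 2 pi is continuous and integer-valued on a connected set. This
  is uniqueness of phase lifts, used to identify lifts that agree at one point.\<close>

lemma cis_eq_imp_diff_const:
  fixes a b :: "'a::topological_space \<Rightarrow> real"
  assumes "connected S" "continuous_on S a" "continuous_on S b"
    and "\<And>x. x \<in> S \<Longrightarrow> cis (a x) = cis (b x)" and "x \<in> S" "y \<in> S"
  shows "a x - b x = a y - b y"
proof -
  let ?f = "\<lambda>x. (a x - b x) / (2 * pi)"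
  have "continuous_on S ?f" using assms by (intro continuous_intros) auto
  moreover have "?f z \<in> \<int>" if "z \<in> S" for z
  proof -
    have "\<exists>n::int. a z = b z + 2 * pi * of_int n" using assms(4)[OF that] cis_eq_iff by blast
    then obtain n :: int where "a z = b z + 2 * pi * of_int n" by blast
    then have "?f z = of_int n" by simp
    then show ?thesis by simp
  qed
  ultimately have "?f constant_on S"
    using assms(1) by (intro continuous_Ints_constant)
  then have "?f x = ?f y" using assms(5,6) unfolding constant_on_def by metis
  then show ?thesis by (simp add: field_simps)
qed

lemma cis_lift_exists:
  fixes F :: "real \<Rightarrow> complex"
  assumes "continuous_on UNIV F" "\<And>t. norm (F t) = 1"
  obtains \<theta> where "continuous_on UNIV \<theta>" "\<And>t. F t = cis (\<theta> t)"
proof -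
  have "\<And>t. F t \<noteq> 0" using assms(2) by (metis norm_zero zero_neq_one)
  then obtain G where G: "continuous_on UNIV G" "\<And>t. F t = exp (G t)"
    using continuous_logarithm_on_contractible[of UNIV F] assms(1) by auto
  have "Re (G t) = 0" for t using assms(2)[of t] G(2)[of t] by simp
  then have "G t = \<i> * of_real (Im (G t))" for t by (simp add: complex_eq_iff)
  then have "F t = cis (Im (G t))" for t using G(2) cis_conv_exp by metis
  moreover have "continuous_on UNIV (\<lambda>t. Im (G t))" using G by (intro continuous_intros)
  ultimately show ?thesis using that by blast
qed

text \<open>The local parameter \<sigma> of a positive curve is itself a lift of the phase, on both
  sides of a change of circle. Near t it differs from \<theta> by a constant and passes on its
  monotonicity.\<close>

lemma strict_mono_phase_lift:
  assumes pos: "\<And>t. positive_at k \<gamma> t"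
    and \<theta>: "continuous_on UNIV \<theta>" "\<And>t. phase (\<gamma> t) = cis (\<theta> t)"
  shows "strict_mono \<theta>"
proof (rule locally_increasing_imp_strict_mono)
  fix t
  obtain \<delta> j j' \<sigma> where \<delta>: "\<delta> > 0" and j: "j \<in> {1..k}" "j' \<in> {1..k}"
    and \<sigma>: "continuous_on {t - \<delta>..t + \<delta>} \<sigma>" "strict_mono_on {t - \<delta>..t + \<delta>} \<sigma>"
    and l: "\<forall>u\<in>{t - \<delta>..t}. \<gamma> u = circ j (\<sigma> u)" and r: "\<forall>u\<in>{t..t + \<delta>}. \<gamma> u = circ j' (\<sigma> u)"
    using pos[of t] unfolding positive_at_def by blast
  have eq: "cis (\<theta> u) = cis (\<sigma> u)" if "u \<in> {t - \<delta>..t + \<delta>}" for u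
    using that l r j \<theta>(2)[of u] phase_circ[of j "\<sigma> u"] phase_circ[of j' "\<sigma> u"]
    by (cases "u \<le> t") simp_all
  have dif: "\<theta> u - \<sigma> u = \<theta> t - \<sigma> t" if "u \<in> {t - \<delta>..t + \<delta>}" for u
    by (rule cis_eq_imp_diff_const[of "{t - \<delta>..t + \<delta>}"])
      (use that \<delta> eq \<sigma>(1) in \<open>auto intro: continuous_on_subset[OF \<theta>(1)]\<close>)
  show "\<exists>\<delta>>0. \<forall>u. (t - \<delta> < u \<and> u < t \<longrightarrow> \<theta> u < \<theta> t) \<and> (t < u \<and> u < t + \<delta> \<longrightarrow> \<theta> t < \<theta> u)"
  proof (intro exI[of _ \<delta>] conjI allI impI \<delta>)
    fix u assume "t - \<delta> < u \<and> u < t"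
    then have "\<sigma> u < \<sigma> t" "\<theta> u - \<sigma> u = \<theta> t - \<sigma> t"
      using \<delta> strict_mono_onD[OF \<sigma>(2), of u t] dif[of u] by simp_all
    then show "\<theta> u < \<theta> t" by simp
  next
    fix u assume "t < u \<and> u < t + \<delta>"
    then have "\<sigma> t < \<sigma> u" "\<theta> u - \<sigma> u = \<theta> t - \<sigma> t"
      using \<delta> strict_mono_onD[OF \<sigma>(2), of t u] dif[of u] by simp_all
    then show "\<theta> t < \<theta> u" by simp
  qed
qed

text \<open>Positivity in a form that survives composition with positive maps. The lift belongs to
  the data because it numbers the circles traversed: letter n occupies the phases from 2 pi n to 2
  pi (n + 1).\<close>

definition mono_curve :: "nat \<Rightarrow> (real \<Rightarrow> complex) \<Rightarrow> (real \<Rightarrow> real) \<Rightarrow> bool" where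
  "mono_curve k c \<theta> \<longleftrightarrow> continuous_on UNIV c \<and> range c \<subseteq> wedge k \<and>
     continuous_on UNIV \<theta> \<and> strict_mono \<theta> \<and> (\<forall>t. phase (c t) = cis (\<theta> t))"

text \<open>The phase intervals are closed: at a common endpoint both letters describe the wedge
  point. A letter whose interval the lift never meets is unconstrained.\<close>

definition reads :: "nat \<Rightarrow> (real \<Rightarrow> complex) \<Rightarrow> (real \<Rightarrow> real) \<Rightarrow> (int \<Rightarrow> nat) \<Rightarrow> bool" where
  "reads k c \<theta> w \<longleftrightarrow> (\<forall>n t. 2 * pi * of_int n \<le> \<theta> t \<longrightarrow> \<theta> t \<le> 2 * pi * (of_int n + 1) \<longrightarrow>
      w n \<in> {1..k} \<and> c t = circ (w n) (\<theta> t))"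

lemma positive_mono_curve:
  assumes "\<And>t. positive_at k c t" "continuous_on UNIV c"
    "continuous_on UNIV \<theta>" "\<And>t. phase (c t) = cis (\<theta> t)" "range c \<subseteq> wedge k"
  shows "mono_curve k c \<theta>"
  using strict_mono_phase_lift[OF assms(1,3,4)] assms by (auto simp: mono_curve_def)

text \<open>Inside one period the curve avoids the wedge point, so \<open>letter\<close> is
  continuous and integer-valued along it, hence constant. Monotonicity of \<theta> makes the set of
  these times an interval.\<close>

lemma mono_curve_reads:
  assumes m: "mono_curve k c \<theta>" and k: "1 \<le> k"
  shows "\<exists>w. reads k c \<theta> w"
proof -
  have c: "continuous_on UNIV c" "\<And>t. c t \<in> wedge k" and th: "continuous_on UNIV \<theta>" "strict_mono \<theta>"
    and ph: "\<And>t. phase (c t) = cis (\<theta> t)" using m by (auto simp: mono_curve_def)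
  have "\<exists>j. \<forall>t. 2 * pi * of_int n \<le> \<theta> t \<longrightarrow> \<theta> t \<le> 2 * pi * (of_int n + 1) \<longrightarrow>
      j \<in> {1..k} \<and> c t = circ j (\<theta> t)" for n :: int
  proof -
    define I where "I = {t. 2 * pi * of_int n < \<theta> t \<and> \<theta> t < 2 * pi * (of_int n + 1)}"
    have nz: "c t \<noteq> 0" if "t \<in> I" for t
    proof
      assume "c t = 0"
      then have "cis (\<theta> t) = 1" using ph[of t] by simp
      then obtain m :: int where "\<theta> t = 2 * pi * of_int m" by (auto simp: cis_eq_1_iff)
      then have "real_of_int n < of_int m" "real_of_int m < of_int n + 1" using that by (auto simp: I_def)
      then have "n < m" "m < n + 1" by linarith+
      then show False by simp
    qed
    have pt: "\<exists>j\<in>{1..k}. c t = circ j (\<theta> t)" for t using wedge_point_eq c ph by blast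
    have bdry: "c t = 0" if "\<theta> t = 2 * pi * of_int m" for t and m :: int
    proof -
      have "cis (\<theta> t) = 1" using that by (auto simp: cis_eq_1_iff)
      then show ?thesis using pt[of t] by (auto simp: circ_eq_0_iff)
    qed
    have bd: "t \<in> I \<or> c t = 0 \<and> cis (\<theta> t) = 1"
      if "2 * pi * of_int n \<le> \<theta> t" "\<theta> t \<le> 2 * pi * (of_int n + 1)" for t
    proof -
      have "t \<in> I \<or> \<theta> t = 2 * pi * of_int n \<or> \<theta> t = 2 * pi * of_int (n + 1)"
        using that by (auto simp: I_def)
      then show ?thesis using bdry[of t n] bdry[of t "n+1"] cis_eq_1_iff by blast
    qed
    show ?thesis
    proof (cases "I = {}")
      case True
      \<comment> \<open>At most endpoints of the period are attained, and there every circle gives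
        the wedge point. The letter 1 is a default, admissible since
        \<open>1 \<le> k\<close>.\<close>
      then show ?thesis using bd k by (intro exI[of _ 1]) (auto simp: circ_eq_0_iff)
    next
      case False
      then obtain t0 where t0: "t0 \<in> I" by blast
      obtain j where j: "j \<in> {1..k}" "c t0 = circ j (\<theta> t0)" using pt by blast
      have ivl: "is_interval I"
        unfolding is_interval_1 I_def using strict_mono_mono[OF th(2)]
        by (auto simp: mono_def intro: less_le_trans le_less_trans)
      have let_nat: "letter (c t) \<in> \<nat>" if "t \<in> I" for t
        using pt[of t] nz[OF that] letter_circ by auto
      have "continuous_on I (\<lambda>t. letter (c t))"
        unfolding letter_def
      proof (intro continuous_intros continuous_on_subset[OF c(1)])
        show "\<forall>t\<in>I. 2 * Re (c t) \<noteq> 0"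
        proof
          fix t assume "t \<in> I"
          from let_nat[OF this] pt[of t] nz[OF this] norm_circ
          show "2 * Re (c t) \<noteq> 0" by (metis mult_eq_0_iff norm_eq_zero power2_eq_square mult_zero_right)
        qed
      qed auto
      then have "(\<lambda>t. letter (c t)) constant_on I"
        using ivl let_nat Nats_subset_Ints
        by (intro continuous_Ints_constant) (auto simp: is_interval_connected)
      then have lc: "letter (c t) = real j" if "t \<in> I" for t
        using that t0 letter_circ nz[OF t0] j by (metis constant_on_def)
      show ?thesis
      proof (intro exI[of _ j] allI impI conjI j)
        fix t assume *: "2 * pi * of_int n \<le> \<theta> t" "\<theta> t \<le> 2 * pi * (of_int n + 1)"
        from bd[OF this] show "c t = circ j (\<theta> t)"
        proof
          assume t: "t \<in> I"
          obtain i where i: "c t = circ i (\<theta> t)" using pt by blast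
          then have "real i = real j" using lc[OF t] nz[OF t] letter_circ by metis
          then show ?thesis using i by simp
        qed (auto simp: circ_eq_0_iff)
      qed
    qed
  qed
  then show ?thesis unfolding reads_def by metis
qed

lemma positive_map_circ_curve:
  assumes f: "positive_map k' k f" and j: "j \<in> {1..k'}"
  obtains \<Theta> where "mono_curve k (\<lambda>s. f (circ j s)) \<Theta>"
proof -
  have r: "range (\<lambda>s. f (circ j s)) \<subseteq> wedge k"
    using f circ_in_wedge[OF j] by (auto simp: positive_map_def)
  have "continuous_on (wedge k') f" using f by (simp add: positive_map_def)
  then have c: "continuous_on UNIV (\<lambda>s. f (circ j s))"
    using continuous_on_circ circ_in_wedge[OF j]
    by (auto intro: continuous_on_compose2)
  then have "continuous_on UNIV (\<lambda>s. phase (f (circ j s)))"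
    using r by (intro continuous_on_compose2[OF continuous_on_phase]) auto
  then obtain \<Theta> where "continuous_on UNIV \<Theta>" "\<And>s. phase (f (circ j s)) = cis (\<Theta> s)"
    using cis_lift_exists[of "\<lambda>s. phase (f (circ j s))"] by auto
  then have "mono_curve k (\<lambda>s. f (circ j s)) \<Theta>"
    using c r f j by (intro positive_mono_curve) (auto simp: positive_map_def)
  then show ?thesis by (rule that)
qed

text \<open>While \<eta> stays within one period, \<gamma> runs along a single circle, on which f
  has an increasing lift. Up to a constant, \<theta> is that lift composed with \<eta>.\<close>

lemma positive_map_mono_curve:
  assumes f: "positive_map k' k f" and k': "1 \<le> k'" and \<gamma>: "mono_curve k' \<gamma> \<eta>"
    and \<theta>: "continuous_on UNIV \<theta>" "\<And>t. phase (f (\<gamma> t)) = cis (\<theta> t)"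
  shows "mono_curve k (\<lambda>t. f (\<gamma> t)) \<theta>"
proof -
  have g: "continuous_on UNIV \<gamma>" "\<And>t. \<gamma> t \<in> wedge k'" and e: "continuous_on UNIV \<eta>" "strict_mono \<eta>"
    using \<gamma> by (auto simp: mono_curve_def)
  obtain w where w: "reads k' \<gamma> \<eta> w" using mono_curve_reads[OF \<gamma> k'] by blast
  have piece: "\<theta> s < \<theta> t" if "s < t" and n: "2 * pi * of_int n \<le> \<eta> s" "\<eta> t \<le> 2 * pi * (of_int n + 1)"
    for s t and n :: int
  proof -
    have rng: "2 * pi * of_int n \<le> \<eta> u \<and> \<eta> u \<le> 2 * pi * (of_int n + 1)" if "u \<in> {s..t}" for u
    proof -
      have "\<eta> s \<le> \<eta> u" "\<eta> u \<le> \<eta> t" using that strict_mono_mono[OF e(2)] by (auto simp: mono_def)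
      then show ?thesis using n by linarith
    qed
    have eq: "w n \<in> {1..k'}" "\<gamma> u = circ (w n) (\<eta> u)" if "u \<in> {s..t}" for u
      using w rng[OF that] by (auto simp: reads_def)
    obtain \<Theta> where \<Theta>: "mono_curve k (\<lambda>s. f (circ (w n) s)) \<Theta>"
      using positive_map_circ_curve[OF f] eq \<open>s < t\<close> by (metis atLeastAtMost_iff less_imp_le order_refl)
    then have T: "continuous_on UNIV \<Theta>" "strict_mono \<Theta>" "\<And>s. phase (f (circ (w n) s)) = cis (\<Theta> s)"
      by (auto simp: mono_curve_def)
    have "\<theta> s - \<Theta> (\<eta> s) = \<theta> t - \<Theta> (\<eta> t)"
    proof (rule cis_eq_imp_diff_const[of "{s..t}" \<theta> "\<lambda>u. \<Theta> (\<eta> u)"])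
      show "continuous_on {s..t} (\<lambda>u. \<Theta> (\<eta> u))"
        using T e by (intro continuous_on_compose2[OF T(1)]) (auto intro: continuous_on_subset)
      show "cis (\<theta> u) = cis (\<Theta> (\<eta> u))" if "u \<in> {s..t}" for u
        using \<theta>(2)[of u] T(3)[of "\<eta> u"] eq[OF that] by simp
    qed (use \<theta> \<open>s < t\<close> in \<open>auto intro: continuous_on_subset\<close>)
    moreover have "\<Theta> (\<eta> s) < \<Theta> (\<eta> t)" using T(2) e(2) \<open>s < t\<close> by (simp add: strict_mono_def)
    ultimately show ?thesis by simp
  qed
  have "strict_mono \<theta>"
  proof (rule locally_increasing_imp_strict_mono)
    fix t
    \<comment> \<open>When \<open>\<eta> t\<close> is a multiple of 2 pi, the circles before and
      after t may differ. The floor selects the period to the right of t, the ceiling minus 1 the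
      period to its left.\<close>
    define n where "n = \<lfloor>\<eta> t / (2*pi)\<rfloor>"
    define m where "m = \<lceil>\<eta> t / (2*pi)\<rceil> - 1"
    have n: "2 * pi * of_int n \<le> \<eta> t" "\<eta> t < 2 * pi * (of_int n + 1)"
      using floor_divide_lower[of "2*pi" "\<eta> t"] floor_divide_upper[of "2*pi" "\<eta> t"] unfolding n_def
      by (simp_all add: mult.commute)
    have m: "2 * pi * of_int m < \<eta> t" "\<eta> t \<le> 2 * pi * (of_int m + 1)"
      using ceiling_divide_lower[of "2*pi" "\<eta> t"] ceiling_divide_upper[of "2*pi" "\<eta> t"] unfolding m_def
      by (simp_all add: mult.commute)
    have "isCont \<eta> t" using e(1) by (simp add: continuous_on_eq_continuous_at)
    then have ev: "(\<eta> \<longlongrightarrow> \<eta> t) (nhds t)" by (simp add: continuous_at tendsto_at_iff_tendsto_nhds)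
    have "\<forall>\<^sub>F u in nhds t. 2 * pi * of_int m < \<eta> u \<and> \<eta> u < 2 * pi * (of_int n + 1)"
      using order_tendstoD[OF ev] n m by (auto intro: eventually_conj)
    then obtain \<delta> where d: "\<delta> > 0" "\<And>u. dist u t < \<delta> \<Longrightarrow> 2 * pi * of_int m < \<eta> u \<and> \<eta> u < 2 * pi * (of_int n + 1)"
      unfolding eventually_nhds_metric by blast
    show "\<exists>\<delta>>0. \<forall>u. (t - \<delta> < u \<and> u < t \<longrightarrow> \<theta> u < \<theta> t) \<and> (t < u \<and> u < t + \<delta> \<longrightarrow> \<theta> t < \<theta> u)"
    proof (intro exI[of _ \<delta>] conjI allI impI d(1))
      fix u assume "t - \<delta> < u \<and> u < t"
      then show "\<theta> u < \<theta> t" using d(2)[of u] m by (intro piece[of u t m]) (auto simp: dist_real_def)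
    next
      fix u assume "t < u \<and> u < t + \<delta>"
      then show "\<theta> t < \<theta> u" using d(2)[of u] n by (intro piece[of t u n]) (auto simp: dist_real_def)
    qed
  qed
  moreover have "continuous_on UNIV (\<lambda>t. f (\<gamma> t))" "range (\<lambda>t. f (\<gamma> t)) \<subseteq> wedge k"
    using f g by (auto simp: positive_map_def intro: continuous_on_compose2)
  ultimately show ?thesis using \<theta> by (auto simp: mono_curve_def)
qed

section \<open>Words, free cancellation and crossings\<close>

definition inv_letter :: "nat \<times> bool \<Rightarrow> nat \<times> bool" where
  "inv_letter l = (fst l, \<not> snd l)"

definition reduced :: "(nat \<times> bool) list \<Rightarrow> bool" where
  "reduced = successively (\<lambda>l m. m \<noteq> inv_letter l)"

text \<open>The free group acts on its reduced words; on non-reduced words \<open>act\<close> is the identity, which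
makes it a bijection of all words.\<close>

definition act :: "nat \<times> bool \<Rightarrow> (nat \<times> bool) list \<Rightarrow> (nat \<times> bool) list" where
  "act l w = (if \<not> reduced w then w else if w \<noteq> [] \<and> hd w = inv_letter l then tl w else l # w)"

abbreviation acts :: "(nat \<times> bool) list \<Rightarrow> (nat \<times> bool) list \<Rightarrow> (nat \<times> bool) list" where
  "acts \<equiv> foldr act"

lemma acts_append [simp]: "acts (u @ v) = acts u \<circ> acts v"
  by (simp add: fun_eq_iff)

text \<open>The exponent sum, that is, the homomorphism from the free group to the integers that
  sends every generator to 1.\<close>

definition deg :: "(nat \<times> bool) list \<Rightarrow> int" where
  "deg w = (\<Sum>l\<leftarrow>w. if snd l then 1 else - 1)"

definition pos :: "nat list \<Rightarrow> (nat \<times> bool) list" where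
  "pos = map (\<lambda>j. (j, True))"

lemma inv_inv_letter [simp]: "inv_letter (inv_letter l) = l"
  by (simp add: inv_letter_def)

lemma inv_letter_pair [simp]: "inv_letter (j, b) = (j, \<not> b)"
  by (simp add: inv_letter_def)

lemma reduced_Nil [simp]: "reduced []"
  and reduced_Cons: "reduced (l # w) \<longleftrightarrow> reduced w \<and> (w \<noteq> [] \<longrightarrow> hd w \<noteq> inv_letter l)"
  by (auto simp: reduced_def successively_Cons)

lemma reduced_act: "reduced w \<Longrightarrow> reduced (act l w)"
  by (cases w) (auto simp: act_def reduced_Cons)

lemma reduced_acts: "reduced w \<Longrightarrow> reduced (acts ls w)"
  by (induction ls) (auto intro: reduced_act)

text \<open>Adjacent inverse letters become invisible when words are compared through
  \<open>acts\<close>, so equality of \<open>acts u\<close> and \<open>acts v\<close> serves as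
  equality in the free group.\<close>

lemma act_inv_letter: "act l (act (inv_letter l) w) = w"
  by (cases w) (auto simp: act_def reduced_Cons)

lemma deg_simps [simp]: "deg [] = 0" "deg (l # w) = (if snd l then 1 else - 1) + deg w"
  "deg (u @ v) = deg u + deg v"
  by (simp_all add: deg_def)

lemma deg_act: "reduced w \<Longrightarrow> deg (act l w) = (if snd l then 1 else - 1) + deg w"
  by (cases w) (auto simp: act_def inv_letter_def)

lemma deg_acts: "reduced w \<Longrightarrow> deg (acts ls w) = deg ls + deg w"
  by (induction ls) (auto simp: deg_act reduced_acts)

lemma length_pos [simp]: "length (pos F) = length F" by (simp add: pos_def)

lemma pos_Cons: "pos (x # F) = (x, True) # pos F" by (simp add: pos_def)

lemma pos_Nil [simp]: "pos [] = []" by (simp add: pos_def)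

lemma deg_pos [simp]: "deg (pos F) = int (length F)"
  by (induction F) (auto simp: pos_Cons)

lemma reduced_pos [simp]: "reduced (pos F)"
proof (induction F)
  case (Cons x F)
  then show ?case by (cases F) (auto simp: pos_Cons reduced_Cons)
qed simp

lemma nth_pos: "p < length F \<Longrightarrow> pos F ! p = (F ! p, True)"
  by (simp add: pos_def)

lemma acts_pos_Nil: "acts (pos F) [] = pos F"
proof (induction F)
  case (Cons x F)
  have "pos F \<noteq> [] \<Longrightarrow> hd (pos F) \<noteq> (x, False)" by (cases F) (auto simp: pos_Cons)
  then show ?case using Cons by (auto simp: pos_Cons act_def)
qed simp

lemma length_act: "length (act l w) \<le> Suc (length w)"
  by (auto simp: act_def)

lemma length_acts: "length (acts ls w) \<le> length ls + length w"
proof (induction ls)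
  case (Cons l ls)
  then show ?case using length_act[of l "acts ls w"] by simp
qed simp

text \<open>Letters of F never cancel among themselves; only the end of F can cancel against the
  beginning of A. Once a letter of F survives, so do all letters to its left.\<close>

lemma acts_pos:
  assumes "reduced A"
  shows "\<exists>m. m \<le> length A \<and> m \<le> length F \<and>
    acts (pos F) A = take (length F - m) (pos F) @ drop m A"
proof (induction F)
  case Nil
  then show ?case by (intro exI[of _ 0]) simp
next
  case (Cons x F)
  then obtain m where m: "m \<le> length A" "m \<le> length F"
    and R: "acts (pos F) A = take (length F - m) (pos F) @ drop m A" by blast
  have red: "reduced (acts (pos F) A)" using assms by (rule reduced_acts)
  show ?case
  proof (cases "acts (pos F) A \<noteq> [] \<and> hd (acts (pos F) A) = (x, False)")
    case True
    \<comment> \<open>A surviving letter of F would be positive and stand in front, so an inverse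
      letter at the head means that F has been used up.\<close>
    have "length F - m = 0"
    proof (rule ccontr)
      assume "length F - m \<noteq> 0"
      then obtain n y F' where "length F - m = Suc n" "F = y # F'"
        by (metis length_0_conv neq_Nil_conv not0_implies_Suc diff_0_eq_0)
      then have "hd (acts (pos F) A) = (y, True)" unfolding R by (simp add: pos_Cons)
      then show False using True by simp
    qed
    then have Rd: "acts (pos F) A = drop m A" "m = length F" using R m by auto
    then have "acts (pos (x # F)) A = drop (Suc m) A" "m < length A"
      using True red by (auto simp: pos_Cons act_def drop_Suc drop_tl)
    then show ?thesis using Rd by (intro exI[of _ "Suc m"]) simp
  next
    case False
    then have "acts (pos (x # F)) A = (x, True) # acts (pos F) A"
      using red by (auto simp: pos_Cons act_def)
    also have "\<dots> = take (length (x # F) - m) (pos (x # F)) @ drop m A"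
      using m R by (simp add: pos_Cons Suc_diff_le)
    finally show ?thesis using m by (intro exI[of _ m]) simp
  qed
qed

text \<open>Each letter of \<open>ls\<close> removes at most one letter of G. The prefix v may
  contain inverse letters, but every step changes \<open>deg v - int m\<close> by the exponent of
  the letter applied.\<close>

lemma acts_on_pos:
  "\<exists>v m. length v \<le> length ls \<and> m \<le> length ls \<and> m \<le> length G \<and> deg v - int m = deg ls \<and>
    acts ls (pos G) = v @ drop m (pos G)"
proof (induction ls)
  case Nil
  then show ?case by (intro exI[of _ "[]"] exI[of _ 0]) simp
next
  case (Cons l ls)
  then obtain v m where vm: "length v \<le> length ls" "m \<le> length ls" "m \<le> length G"
    "deg v - int m = deg ls" and R: "acts ls (pos G) = v @ drop m (pos G)" by blast
  have red: "reduced (acts ls (pos G))" by (simp add: reduced_acts)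
  show ?case
  proof (cases "acts ls (pos G) \<noteq> [] \<and> hd (acts ls (pos G)) = inv_letter l")
    case False
    then have "acts (l # ls) (pos G) = (l # v) @ drop m (pos G)"
      using red R by (auto simp: act_def)
    then show ?thesis using vm by (intro exI[of _ "l # v"] exI[of _ m]) auto
  next
    case True
    then have e: "acts (l # ls) (pos G) = tl (v @ drop m (pos G))" using red R by (simp add: act_def)
    show ?thesis
    proof (cases v)
      case (Cons a v')
      have "a = inv_letter l" using True R Cons by simp
      then show ?thesis using vm e Cons
        by (intro exI[of _ v'] exI[of _ m]) (auto simp: inv_letter_def)
    next
      case Nil
      \<comment> \<open>A letter that cancels a positive one is an inverse letter, so raising m by
        one accounts for its exponent.\<close>
      then have "drop m (pos G) \<noteq> []" "hd (drop m (pos G)) = inv_letter l" using True R by auto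
      then have m: "m < length G" "inv_letter l = (G ! m, True)"
        by (auto simp: hd_drop_conv_nth nth_pos)
      then have "\<not> snd l" by (auto simp: inv_letter_def)
      then show ?thesis using vm e m Nil
        by (intro exI[of _ "[]"] exI[of _ "Suc m"]) (auto simp: drop_Suc tl_drop)
    qed
  qed
qed

text \<open>Away from the ends, position p shows a letter of F on the right-hand side and a letter
  of G, moved by \<open>m - length v\<close>, on the left-hand side. This move equals minus the
  exponent sum of \<open>ls\<close>, hence is the same for all F and G.\<close>

lemma conjugate_positive_words:
  assumes "acts ls (acts (pos G) []) = acts (pos F) (acts ls [])"
  shows "length F = length G"
    and "length ls \<le> p \<Longrightarrow> p + length ls < length F \<Longrightarrow>
      0 \<le> int p - deg ls \<and> int p - deg ls < int (length G) \<and> F ! p = G ! nat (int p - deg ls)"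
proof -
  have eq: "acts ls (pos G) = acts (pos F) (acts ls [])" using assms by (simp add: acts_pos_Nil)
  have "deg (acts ls (pos G)) = deg ls + int (length G)" by (simp add: deg_acts)
  moreover have "deg (acts (pos F) (acts ls [])) = int (length F) + deg ls"
    by (simp add: deg_acts reduced_acts)
  ultimately show len: "length F = length G" using eq by simp
  assume p: "length ls \<le> p" "p + length ls < length F"
  obtain v m where v: "length v \<le> length ls" "m \<le> length ls" "m \<le> length G" "deg v - int m = deg ls"
    and L: "acts ls (pos G) = v @ drop m (pos G)" using acts_on_pos by blast
  obtain m' where m': "m' \<le> length (acts ls [])" "m' \<le> length F"
    and R: "acts (pos F) (acts ls []) = take (length F - m') (pos F) @ drop m' (acts ls [])"
    using acts_pos[OF reduced_acts[OF reduced_Nil]] by blast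
  let ?u = "v @ drop m (pos G)"
  have m'l: "m' \<le> length ls" using m' length_acts[of ls "[]"] by simp
  have u: "?u = take (length F - m') (pos F) @ drop m' (acts ls [])" using eq L R by simp
  have uq: "?u ! q = (F ! q, True)" if "q < length F - m'" for q
    using that unfolding u by (simp add: nth_append nth_pos)
  \<comment> \<open>The prefix v occupies positions filled by F on the other side, so it is a
    positive word and its exponent sum is its length.\<close>
  have "v = pos (map fst v)"
  proof (rule nth_equalityI)
    fix q assume q: "q < length v"
    then have "v ! q = (F ! q, True)" using uq[of q] p v m'l by (simp add: nth_append)
    then show "v ! q = pos (map fst v) ! q" using q by (simp add: nth_pos)
  qed simp
  then have "deg v = int (length v)" using deg_pos by (metis length_map)
  then have d: "int p - deg ls = int (p - length v + m)" using v p by simp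
  have "length ?u = length F - m' + (length (acts ls []) - m')" unfolding u using m' by simp
  then have "p < length ?u" using p m'l by linarith
  then have lt: "p - length v + m < length G" using v p by simp
  have "?u ! p = (G ! (p - length v + m), True)"
    using v p lt by (simp add: nth_append nth_pos add.commute)
  moreover have "?u ! p = (F ! p, True)" using uq p m'l by simp
  ultimately show "0 \<le> int p - deg ls \<and> int p - deg ls < int (length G) \<and> F ! p = G ! nat (int p - deg ls)"
    unfolding d nat_int using lt by simp
qed

text \<open>For nearby points, \<open>cross\<close> records a passage through the point \<open>2 * j\<close> of circle \<open>j\<close>
antipodal to the wedge point. Near the wedge point circles may be arbitrarily close to each other,
but there nothing is recorded.\<close>

definition cross :: "complex \<Rightarrow> complex \<Rightarrow> (nat \<times> bool) list" where
  "cross z w = (if letter z = letter w \<and> letter z < Re z \<and> letter w < Re w then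
     (if Im z < 0 \<and> 0 \<le> Im w then [(nat \<lfloor>letter z\<rfloor>, True)]
      else if 0 \<le> Im z \<and> Im w < 0 then [(nat \<lfloor>letter z\<rfloor>, False)] else []) else [])"

lemma cross_same [simp]: "cross z z = []" by (simp add: cross_def)

lemma letter_0 [simp]: "letter 0 = 0" by (simp add: letter_def)

lemma wedge_letter:
  assumes "z \<in> wedge k" "z \<noteq> 0"
  obtains j where "j \<in> {1..k}" "letter z = real j" "(cmod z)\<^sup>2 = 2 * real j * Re z"
  using assms letter_circ norm_circ by (auto simp: wedge_iff)

text \<open>A point z of circle i satisfies |z - j|^2 - j^2 = 2 (i - j) Re z. Closeness to circle j
  keeps this below 3 in absolute value, whereas \<open>3 / 2 < Re z\<close> would make it at least 3
  for distinct i and j.\<close>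

lemma near_right_point:
  assumes z: "z \<in> wedge k" and w: "w \<in> wedge k" and d: "dist z w < 1 / (2 * real k)"
    and r: "3 / 2 * letter z < Re z"
  shows "letter w = letter z \<and> letter w < Re w"
proof -
  have "z \<noteq> 0" using r by auto
  then obtain i where i: "i \<in> {1..k}" "letter z = real i" "(cmod z)\<^sup>2 = 2 * real i * Re z"
    using z wedge_letter by blast
  obtain j s where j: "j \<in> {1..k}" "w = circ j s" using w by (auto simp: wedge_iff)
  have k: "1 \<le> real k" "1 \<le> real i" "1 \<le> real j" "real j \<le> real k" using i j by auto
  define e where "e = 1 / (2 * real k)"
  have e: "0 < e" "e \<le> 1/2" "e * real j \<le> 1/2" using k by (auto simp: e_def field_simps)
  have wj: "cmod (w - of_nat j) = real j" by (simp add: j circ_cis algebra_simps norm_mult)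
  have dz: "cmod (z - w) < e" using d by (simp add: dist_norm e_def)
  define r where "r = cmod (z - of_nat j)"
  have "\<bar>r - real j\<bar> < e"
    using norm_triangle_ineq3[of "z - of_nat j" "w - of_nat j"] wj dz by (simp add: r_def)
  moreover have r0: "0 \<le> r" by (simp add: r_def)
  ultimately have "\<bar>(r - real j) * (r + real j)\<bar> \<le> e * (2 * real j + e)"
    unfolding abs_mult using k by (intro mult_mono) auto
  also have "\<dots> = 2 * (e * real j) + e * e" by (simp add: algebra_simps)
  also have "\<dots> \<le> 2 * (1/2) + 1/2 * (1/2)" using e by (intro add_mono mult_left_mono mult_mono) auto
  finally have a: "\<bar>(r - real j) * (r + real j)\<bar> < 3" by simp
  have "(r - real j) * (r + real j) = r\<^sup>2 - (real j)\<^sup>2" by (simp add: power2_eq_square algebra_simps)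
  also have "r\<^sup>2 = (cmod z)\<^sup>2 - 2 * real j * Re z + (real j)\<^sup>2"
    unfolding r_def cmod_power2 by (simp add: power2_eq_square algebra_simps)
  finally have b: "(r - real j) * (r + real j) = 2 * (real i - real j) * Re z"
    using i by (simp add: algebra_simps)
  have rz: "3/2 < Re z" using r k i by simp
  have "i = j"
  proof (rule ccontr)
    assume "i \<noteq> j"
    then have "1 \<le> \<bar>real i - real j\<bar>" by linarith
    then have "1 * (3/2) \<le> \<bar>real i - real j\<bar> * \<bar>Re z\<bar>" using rz by (intro mult_mono) auto
    moreover have "\<bar>2 * (real i - real j) * Re z\<bar> = 2 * (\<bar>real i - real j\<bar> * \<bar>Re z\<bar>)"
      by (simp only: abs_mult abs_numeral mult.assoc)
    ultimately show False using a unfolding b by simp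
  qed
  have "\<bar>Re z - Re w\<bar> < e" using abs_Re_le_cmod[of "z - w"] dz by simp
  then have "real j < Re w" using assms(4) i k e \<open>i = j\<close> by simp
  moreover from this have "w \<noteq> 0" by auto
  ultimately show ?thesis using letter_circ i j \<open>i = j\<close> by simp
qed

text \<open>Here the square of \<open>Im z\<close> is at least 3/4 of the squared radius, so |Im z|
  is at least 1/2, while w is nearer than 1/2. The sign of the imaginary part cannot change.\<close>

lemma near_left_point:
  assumes z: "z \<in> wedge k" and w: "w \<in> wedge k" and d: "dist z w < 1 / (2 * real k)"
    and r: "letter z < Re z" "Re z \<le> 3 / 2 * letter z"
  shows "Im z < 0 \<longleftrightarrow> Im w < 0"
proof -
  have "z \<noteq> 0" using r by auto
  then obtain i where i: "i \<in> {1..k}" "letter z = real i" "(cmod z)\<^sup>2 = 2 * real i * Re z"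
    using z wedge_letter by blast
  have k: "1 \<le> real k" "1 \<le> real i" using i by auto
  then have "1 / (2 * real k) \<le> 1/2" by (simp add: field_simps)
  then have "cmod (z - w) < 1/2" using d by (simp add: dist_norm)
  then have im: "\<bar>Im z - Im w\<bar> < 1/2" using abs_Im_le_cmod[of "z - w"] by simp
  have "(Im z)\<^sup>2 = (real i)\<^sup>2 - (Re z - real i)\<^sup>2"
    using i(3) unfolding cmod_power2 by (simp add: power2_eq_square algebra_simps)
  moreover have "(Re z - real i)\<^sup>2 \<le> (real i / 2)\<^sup>2" using r i by (intro power_mono) auto
  moreover have "1 \<le> (real i)\<^sup>2" using k by simp
  ultimately have "(1/2)\<^sup>2 \<le> (Im z)\<^sup>2" by (simp add: power_divide)
  then have "1/2 \<le> \<bar>Im z\<bar>" by (metis abs_le_square_iff abs_of_nonneg zero_le_divide_1_iff zero_le_numeral)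
  then show ?thesis using im by linarith
qed

text \<open>If one point is far to the right, all three lie in the right half of one circle, and
  \<open>cross\<close> records changes of sign of \<open>Im\<close>, which compose up to
  cancellation. Otherwise nothing is recorded. Actions are compared because a passage and its
  reversal cancel only in the group.\<close>

lemma cross_cocycle:
  assumes "z \<in> wedge k" "w \<in> wedge k" "v \<in> wedge k"
    and "dist z w < 1 / (2 * real k)" "dist w v < 1 / (2 * real k)" "dist z v < 1 / (2 * real k)"
  shows "acts (cross z w @ cross w v) = acts (cross z v)"
proof -
  let ?e = "1 / (2 * real k)"
  let ?P = "\<lambda>x. x \<in> {z, w, v}"
  have cl: "x \<in> wedge k" "y \<in> wedge k" "x \<noteq> y \<Longrightarrow> dist x y < ?e" if "?P x" "?P y" for x y
    using assms that by (auto simp: dist_commute)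
  show ?thesis
  proof (cases "\<exists>x. ?P x \<and> 3/2 * letter x < Re x")
    case True
    then obtain x where x: "?P x" "3/2 * letter x < Re x" by blast
    have "x \<noteq> 0" using x by auto
    then obtain j where "letter x = real j" using cl[OF x(1) x(1)] wedge_letter by metis
    then have *: "letter y = real j \<and> real j < Re y" if "?P y" for y
    proof (cases "y = x")
      case False
      then show ?thesis using near_right_point[of x k y] cl[OF x(1) that] x \<open>letter x = real j\<close> by simp
    qed (use x in \<open>auto simp: \<open>letter x = real j\<close>\<close>)
    have "letter z = real j" "letter w = real j" "letter v = real j"
      "real j < Re z" "real j < Re w" "real j < Re v" using * by auto
    then show ?thesis
      using act_inv_letter[of "(j, True)"] act_inv_letter[of "(j, False)"]
      by (auto simp: cross_def fun_eq_iff)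
  next
    case False
    then have *: "cross x y = []" if "?P x" "?P y" for x y
    proof (cases "x = y \<or> \<not> letter x < Re x")
      case True
      then show ?thesis by (auto simp: cross_def)
    next
      case F: False
      have "Re x \<le> 3/2 * letter x" using False that by (meson linorder_not_le)
      then have "Im x < 0 \<longleftrightarrow> Im y < 0" using near_left_point[of x k y] cl[OF that] F by blast
      then show ?thesis by (auto simp: cross_def)
    qed
    have "cross z w = []" "cross w v = []" "cross z v = []" using * by auto
    then show ?thesis by simp
  qed
qed

section \<open>Words of sampled paths and their homotopy invariance\<close>

definition crossings :: "(nat \<Rightarrow> complex) \<Rightarrow> nat \<Rightarrow> (nat \<times> bool) list" where
  "crossings z n = concat (map (\<lambda>i. cross (z i) (z (Suc i))) [0..<n])"

lemma crossings_0 [simp]: "crossings z 0 = []"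
  and crossings_Suc: "crossings z (Suc n) = crossings z n @ cross (z n) (z (Suc n))"
  by (simp_all add: crossings_def)

lemma crossings_add: "crossings z (m + n) = crossings z m @ crossings (\<lambda>i. z (m + i)) n"
  by (induction n) (simp_all add: crossings_Suc)

lemma crossings_cong: "(\<And>i. i \<le> n \<Longrightarrow> z i = w i) \<Longrightarrow> crossings z n = crossings w n"
  unfolding crossings_def by (intro arg_cong[of _ _ concat] map_cong) auto

text \<open>Each square between consecutive rungs is cut by the diagonal from \<open>z i\<close> to
  \<open>w (Suc i)\<close> into two triangles, to which \<open>cross_cocycle\<close>
  applies.\<close>

lemma crossings_ladder:
  assumes "\<And>i. i \<le> n \<Longrightarrow> z i \<in> wedge k \<and> w i \<in> wedge k \<and> dist (z i) (w i) < 1 / (2 * real k)"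
    and "\<And>i. i < n \<Longrightarrow> dist (z i) (z (Suc i)) < 1 / (2 * real k) \<and>
      dist (w i) (w (Suc i)) < 1 / (2 * real k) \<and> dist (z i) (w (Suc i)) < 1 / (2 * real k)"
  shows "acts (crossings z n @ cross (z n) (w n)) = acts (cross (z 0) (w 0) @ crossings w n)"
  using assms
proof (induction n)
  case (Suc n)
  have "acts (cross (z n) (z (Suc n)) @ cross (z (Suc n)) (w (Suc n))) = acts (cross (z n) (w (Suc n)))"
    using Suc.prems(1)[of n] Suc.prems(1)[of "Suc n"] Suc.prems(2)[of n] by (intro cross_cocycle[of _ k]) auto
  also have "\<dots> = acts (cross (z n) (w n) @ cross (w n) (w (Suc n)))"
    using Suc.prems(1)[of n] Suc.prems(1)[of "Suc n"] Suc.prems(2)[of n] by (intro cross_cocycle[of _ k, symmetric]) auto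
  finally have "acts (crossings z (Suc n) @ cross (z (Suc n)) (w (Suc n))) =
     acts (crossings z n @ cross (z n) (w n)) \<circ> acts (cross (w n) (w (Suc n)))"
    by (simp add: crossings_Suc comp_assoc)
  also have "acts (crossings z n @ cross (z n) (w n)) = acts (cross (z 0) (w 0) @ crossings w n)"
    using Suc by (intro Suc.IH) auto
  finally show ?case by (simp add: crossings_Suc comp_assoc)
qed simp

lemma crossings_block:
  assumes "\<And>i. i \<le> n \<Longrightarrow> z i \<in> wedge k"
    and "\<And>i j. i \<le> n \<Longrightarrow> j \<le> n \<Longrightarrow> dist (z i) (z j) < 1 / (2 * real k)"
  shows "acts (crossings z n) = acts (cross (z 0) (z n))"
  using assms
proof (induction n)
  case (Suc n)
  have "acts (crossings z (Suc n)) = acts (crossings z n) \<circ> acts (cross (z n) (z (Suc n)))"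
    by (simp add: crossings_Suc)
  also have "\<dots> = acts (cross (z 0) (z n) @ cross (z n) (z (Suc n)))" using Suc by simp
  also have "\<dots> = acts (cross (z 0) (z (Suc n)))"
    using Suc.prems by (intro cross_cocycle[of _ k]) auto
  finally show ?case .
qed simp

abbreviation samples :: "(real \<Rightarrow> complex) \<Rightarrow> nat \<Rightarrow> (nat \<times> bool) list" where
  "samples c n \<equiv> crossings (\<lambda>i. c (real i / real n)) n"

text \<open>The mesh needed for a homotopy depends on the loop, but the word of the conjugating path
  must be bounded independently of the loop. Passing to multiples of one fine mesh changes that word
  only by cancellation, which reconciles the two demands.\<close>

lemma samples_refine:
  assumes p: "path p" "path_image p \<subseteq> wedge k" and k: "1 \<le> k"
  shows "\<exists>N0>0. \<forall>N\<ge>N0. \<forall>K>0. acts (samples p (N * K)) = acts (samples p N)"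
proof -
  have "uniformly_continuous_on {0..1} p"
    using p by (intro compact_uniformly_continuous) (auto simp: path_def)
  moreover have e: "1 / (2 * real k) > 0" using k by simp
  ultimately obtain \<delta> where d: "\<delta> > 0" "\<And>s t. s \<in> {0..1} \<Longrightarrow> t \<in> {0..1} \<Longrightarrow> dist s t < \<delta> \<Longrightarrow> dist (p s) (p t) < 1 / (2 * real k)"
    using e unfolding uniformly_continuous_on_def by meson
  obtain N0 :: nat where N0: "N0 > 0" "1 / real N0 < \<delta>"
    using d(1) by (metis nat_approx_posE zero_less_Suc)
  have main: "acts (samples p (N * K)) = acts (samples p N)" if N: "N \<ge> N0" and K: "K > 0" for N K
  proof -
    have Np: "N > 0" using N N0 by simp
    let ?z = "\<lambda>i. p (real i / real (N * K))"
    have inw: "p s \<in> wedge k" if "s \<in> {0..1}" for s using p that by (auto simp: path_image_def)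
    have rng: "real i / real (N * K) \<in> {0..1}" if "i \<le> N * K" for i
      using that Np K by (simp add: divide_simps flip: of_nat_mult)
    have dN: "1 / real N < \<delta>"
    proof -
      have "1 / real N \<le> 1 / real N0" using N N0 by (simp add: field_simps)
      then show ?thesis using N0 by simp
    qed
    have blk: "acts (crossings (\<lambda>i. ?z (m * K + i)) K) = acts (cross (p (real m / real N)) (p (real (Suc m) / real N)))"
      if m: "m < N" for m
    proof -
      have le: "m * K + i \<le> N * K" if "i \<le> K" for i
      proof -
        have "m * K + i \<le> Suc m * K" using that by simp
        also have "\<dots> \<le> N * K" using m by (intro mult_le_mono1) simp
        finally show ?thesis .
      qed
      have "acts (crossings (\<lambda>i. ?z (m * K + i)) K) = acts (cross (?z (m * K + 0)) (?z (m * K + K)))"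
      proof (rule crossings_block[of _ _ k])
        fix i j assume ij: "i \<le> K" "j \<le> K"
        have "dist (real (m * K + i) / real (N * K)) (real (m * K + j) / real (N * K)) =
           \<bar>real i - real j\<bar> / (real N * real K)"
          by (simp add: dist_real_def flip: diff_divide_distrib)
        also have "\<dots> \<le> real K / (real N * real K)" using ij by (intro divide_right_mono) auto
        also have "\<dots> = 1 / real N" using K by simp
        finally show "dist (?z (m * K + i)) (?z (m * K + j)) < 1 / (2 * real k)"
          using dN by (intro d(2) rng le ij) simp
      qed (use inw rng le in blast)
      also have "real (m * K + 0) / real (N * K) = real m / real N" using K by simp
      also have "real (m * K + K) / real (N * K) = real (Suc m) / real N"
        using K Np by (simp add: field_simps)
      finally show ?thesis .
    qed
    have "acts (crossings ?z (m * K)) = acts (crossings (\<lambda>i. p (real i / real N)) m)" if "m \<le> N" for m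
      using that
    proof (induction m)
      case (Suc m)
      have "acts (crossings ?z (Suc m * K)) = acts (crossings ?z (m * K)) \<circ> acts (crossings (\<lambda>i. ?z (m * K + i)) K)"
        using crossings_add[of ?z "m * K" K] by (simp add: add.commute)
      also have "\<dots> = acts (crossings (\<lambda>i. p (real i / real N)) m) \<circ> acts (cross (p (real m / real N)) (p (real (Suc m) / real N)))"
        using Suc blk by simp
      finally show ?case by (simp add: crossings_Suc)
    qed simp
    then show ?thesis by simp
  qed
  then show ?thesis using N0(1) by blast
qed

text \<open>A fine grid on the domain of the homotopy turns neighbouring rows into ladders. The end
  columns are constant, so the outer rungs record nothing.\<close>

lemma samples_homotopic:
  assumes h: "homotopic_paths (wedge k) p q" and k: "1 \<le> k"
  shows "\<exists>N0>0. \<forall>N\<ge>N0. acts (samples p N) = acts (samples q N)"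
proof -
  from h[unfolded homotopic_paths] obtain H where *: "continuous_on ({0..1::real} \<times> {0..1}) H \<and>
      H \<in> {0..1} \<times> {0..1} \<rightarrow> wedge k \<and> (\<forall>x\<in>{0..1}. H (0, x) = p x) \<and> (\<forall>x\<in>{0..1}. H (1, x) = q x) \<and>
      (\<forall>t\<in>{0..1}. pathstart (H \<circ> Pair t) = pathstart p \<and> pathfinish (H \<circ> Pair t) = pathfinish p)" ..
  then have H: "continuous_on ({0..1} \<times> {0..1}) H" "H \<in> {0..1} \<times> {0..1} \<rightarrow> wedge k"
    "\<forall>x\<in>{0..1}. H (0, x) = p x" "\<forall>x\<in>{0..1}. H (1, x) = q x"
    and ends': "\<forall>t\<in>{0..1}. pathstart (H \<circ> Pair t) = pathstart p \<and> pathfinish (H \<circ> Pair t) = pathfinish p"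
    by simp_all
  have ends: "H (t, 0) = p 0 \<and> H (t, 1) = p 1" if "t \<in> {0..1}" for t
    using ends' that by (auto simp: pathstart_def pathfinish_def)
  have "uniformly_continuous_on ({0..1} \<times> {0..1}) H"
    using H(1) by (intro compact_uniformly_continuous compact_Times) auto
  moreover have e: "1 / (2 * real k) > 0" using k by simp
  ultimately obtain \<delta> where d: "\<delta> > 0" "\<And>s t. s \<in> {0..1} \<times> {0..1} \<Longrightarrow> t \<in> {0..1} \<times> {0..1} \<Longrightarrow> dist s t < \<delta> \<Longrightarrow> dist (H s) (H t) < 1 / (2 * real k)"
    using e unfolding uniformly_continuous_on_def by meson
  obtain N0 :: nat where N0: "N0 > 0" "1 / real N0 < \<delta> / 2"
    using d(1) by (metis nat_approx_posE zero_less_Suc half_gt_zero)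
  have "acts (samples p N) = acts (samples q N)" if N: "N \<ge> N0" for N
  proof -
    have Np: "N > 0" using N N0 by simp
    have dN: "1 / real N < \<delta> / 2"
    proof -
      have "1 / real N \<le> 1 / real N0" using N N0 by (simp add: field_simps)
      then show ?thesis using N0 by simp
    qed
    let ?z = "\<lambda>m i. H (real m / real N, real i / real N)"
    have inw: "?z m i \<in> wedge k" if "m \<le> N" "i \<le> N" for m i
      using that Np H(2) by (auto simp: Pi_iff)
    have near: "dist (?z m i) (?z m' i') < 1 / (2 * real k)"
      if "m \<le> N" "i \<le> N" "m' \<le> N" "i' \<le> N" "\<bar>real m - real m'\<bar> \<le> 1" "\<bar>real i - real i'\<bar> \<le> 1" for m i m' i'
    proof (rule d(2))
      have "dist (real m / real N, real i / real N) (real m' / real N, real i' / real N)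
          \<le> dist (real m / real N) (real m' / real N) + dist (real i / real N) (real i' / real N)"
        unfolding dist_Pair_Pair by (rule sqrt_sum_squares_le_sum) auto
      also have "\<dots> = \<bar>real m - real m'\<bar> / real N + \<bar>real i - real i'\<bar> / real N"
        by (simp add: dist_real_def flip: diff_divide_distrib)
      also have "\<dots> \<le> 1 / real N + 1 / real N" using that by (intro add_mono divide_right_mono) auto
      finally show "dist (real m / real N, real i / real N) (real m' / real N, real i' / real N) < \<delta>"
        using dN by simp
    qed (use that Np in auto)
    have "acts (crossings (?z m) N) = acts (crossings (?z 0) N)" if "m \<le> N" for m
      using that
    proof (induction m)
      case (Suc m)
      have "acts (crossings (?z m) N @ cross (?z m N) (?z (Suc m) N)) =
         acts (cross (?z m 0) (?z (Suc m) 0) @ crossings (?z (Suc m)) N)"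
      proof (intro crossings_ladder[of _ _ k])
        fix i assume "i \<le> N"
        then show "?z m i \<in> wedge k \<and> ?z (Suc m) i \<in> wedge k \<and> dist (?z m i) (?z (Suc m) i) < 1 / (2 * real k)"
          using Suc.prems by (intro conjI inw near) simp_all
      next
        fix i assume "i < N"
        then show "dist (?z m i) (?z m (Suc i)) < 1 / (2 * real k) \<and>
            dist (?z (Suc m) i) (?z (Suc m) (Suc i)) < 1 / (2 * real k) \<and>
            dist (?z m i) (?z (Suc m) (Suc i)) < 1 / (2 * real k)"
          using Suc.prems by (intro conjI near) simp_all
      qed
      moreover have "?z m N = ?z (Suc m) N" "?z m 0 = ?z (Suc m) 0"
        using Suc.prems Np ends[of "real m / real N"] ends[of "real (Suc m) / real N"] by auto
      ultimately show ?case using Suc by simp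
    qed simp
    from this[of N] have "acts (crossings (?z N) N) = acts (crossings (?z 0) N)" by simp
    moreover have "crossings (?z N) N = samples q N" "crossings (?z 0) N = samples p N"
      using Np H(3,4) by (auto intro!: crossings_cong)
    ultimately show ?thesis by simp
  qed
  then show ?thesis using N0(1) by blast
qed

text \<open>An even number of steps puts a sample exactly at the junction 1/2.\<close>

lemma samples_join:
  assumes "N > 0" "pathfinish p = pathstart q"
  shows "samples (p +++ q) (2 * N) = samples p N @ samples q N"
proof -
  let ?z = "\<lambda>i. (p +++ q) (real i / real (2 * N))"
  have "samples (p +++ q) (2 * N) = crossings ?z N @ crossings (\<lambda>i. ?z (N + i)) N"
    by (simp only: mult_2 crossings_add)
  also have "crossings ?z N = samples p N"
  proof (rule crossings_cong)
    fix i assume "i \<le> N"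
    then have "real i / real (2 * N) \<le> 1/2" "2 * (real i / real (2 * N)) = real i / real N"
      using assms(1) by (simp_all add: divide_simps)
    then show "?z i = p (real i / real N)" by (simp only: joinpaths_def if_True)
  qed
  also have "crossings (\<lambda>i. ?z (N + i)) N = samples q N"
  proof (rule crossings_cong)
    fix i assume "i \<le> N"
    show "?z (N + i) = q (real i / real N)"
    proof (cases "i = 0")
      case True
      then show ?thesis using assms by (simp add: joinpaths_def pathfinish_def pathstart_def)
    next
      case False
      then have "\<not> real (N + i) / real (2 * N) \<le> 1/2" "2 * (real (N + i) / real (2 * N)) - 1 = real i / real N"
        using assms(1) by (simp_all add: divide_simps)
      then show ?thesis by (simp only: joinpaths_def if_False)
    qed
  qed
  finally show ?thesis .
qed

section \<open>Words of positive curves and of conjugate loops\<close>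

lemma mono_curve_point:
  assumes r: "reads k c \<theta> w" and n: "2 * pi * of_int n \<le> \<theta> t" "\<theta> t < 2 * pi * (of_int n + 1)"
  shows "w n \<in> {1..k}" "letter (c t) < Re (c t) \<longleftrightarrow> cos (\<theta> t) < 0"
    and "letter (c t) < Re (c t) \<Longrightarrow> letter (c t) = real (w n)" and "Im (c t) < 0 \<longleftrightarrow> 0 < sin (\<theta> t)"
proof -
  have c: "w n \<in> {1..k}" "c t = circ (w n) (\<theta> t)" using r n by (auto simp: reads_def)
  then show "w n \<in> {1..k}" by simp
  have w: "0 < real (w n)" using c by auto
  show "letter (c t) < Re (c t) \<Longrightarrow> letter (c t) = real (w n)"
    using c letter_circ by (metis letter_0 less_irrefl zero_complex.simps(1))
  show "Im (c t) < 0 \<longleftrightarrow> 0 < sin (\<theta> t)" using w by (simp add: c Im_circ zero_less_mult_iff)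
  show "letter (c t) < Re (c t) \<longleftrightarrow> cos (\<theta> t) < 0"
  proof (cases "c t = 0")
    case True
    then have "cis (\<theta> t) = 1" using c circ_eq_0_iff by auto
    then have "cos (\<theta> t) = 1" by (metis cis.sel(1) one_complex.sel(1))
    then show ?thesis using True by simp
  next
    case False
    then have "letter (c t) = real (w n)" using letter_circ c by simp
    moreover have "real (w n) < real (w n) * (1 - cos (\<theta> t)) \<longleftrightarrow> real (w n) * cos (\<theta> t) < 0"
      by (simp add: algebra_simps)
    ultimately show ?thesis using w by (simp add: c Re_circ mult_less_0_iff)
  qed
qed

text \<open>N counts antipodes: it jumps exactly at odd multiples of pi, and the jump from n to n +
  1 lies in the middle of letter n. There \<open>Im\<close>, a negative multiple of the sine of the
  phase, passes from negative to nonnegative. A step below pi / 4 meets at most one antipode, and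
  then both its ends are in the right half.\<close>

lemma cross_mono_curve:
  assumes r: "reads k c \<theta> w" and t: "\<theta> s \<le> \<theta> t" "\<theta> t < \<theta> s + pi / 4"
  defines "N \<equiv> \<lambda>t. \<lfloor>(\<theta> t + pi) / (2 * pi)\<rfloor>"
  shows "N t \<in> {N s, N s + 1}" "cross (c s) (c t) = pos (map w [N s..N t - 1])"
proof -
  define n where "n = N s"
  define x where "x = \<theta> s - 2 * pi * of_int n"
  define y where "y = \<theta> t - 2 * pi * of_int n"
  have s: "\<theta> s = x + 2 * pi * of_int n" "\<theta> t = y + 2 * pi * of_int n" by (auto simp: x_def y_def)
  have cs: "cos (\<theta> s) = cos x" "sin (\<theta> s) = sin x" "cos (\<theta> t) = cos y" "sin (\<theta> t) = sin y"
    using s cis_eq_iff[of "\<theta> s" x] cis_eq_iff[of "\<theta> t" y] by (metis cis.sel)+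
  have n: "of_int n * (2 * pi) \<le> \<theta> s + pi" "\<theta> s + pi < (of_int n + 1) * (2 * pi)"
    unfolding n_def N_def by (rule floor_divide_lower floor_divide_upper, simp)+
  then have x: "- pi \<le> x" "x < pi" using s by (simp_all add: algebra_simps)
  have xy: "x \<le> y" "y < x + pi / 4" using t s by auto
  have nt: "N t = n" if "y < pi"
    unfolding N_def using that xy x s(2) by (intro floor_unique) (simp_all add: divide_simps algebra_simps)
  have nt': "N t = n + 1" if "pi \<le> y"
    unfolding N_def using that xy x s(2) by (intro floor_unique) (simp_all add: divide_simps algebra_simps)
  show "N t \<in> {N s, N s + 1}" using nt nt' n_def by (cases "y < pi") auto
  have pt: "\<exists>m. 2 * pi * of_int m \<le> \<theta> u \<and> \<theta> u < 2 * pi * (of_int m + 1)" for u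
    using floor_divide_lower[of "2 * pi" "\<theta> u"] floor_divide_upper[of "2 * pi" "\<theta> u"]
    by (intro exI[of _ "\<lfloor>\<theta> u / (2 * pi)\<rfloor>"]) (simp add: mult.commute)
  have right: "letter (c u) < Re (c u) \<longleftrightarrow> cos (\<theta> u) < 0" and up: "Im (c u) < 0 \<longleftrightarrow> 0 < sin (\<theta> u)" for u
    using pt[of u] mono_curve_point[OF r] by blast+
  show "cross (c s) (c t) = pos (map w [N s..N t - 1])"
  proof (cases "y < pi")
    case False
    then have y: "pi \<le> y" by simp
    then have x': "3 * pi / 4 < x" using xy by simp
    have "cos x < 0"
      using cos_gt_zero_pi[of "x - pi"] x x' by (simp add: cos_minus_pi)
    moreover have "sin x > 0" using x x' by (intro sin_gt_zero) auto
    moreover have "cos y < 0" using cos_gt_zero_pi[of "y - pi"] xy y x by (simp add: cos_minus_pi)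
    moreover have "\<not> 0 < sin y" using sin_ge_zero[of "y - pi"] xy y x by (simp add: sin_minus_pi)
    moreover have "letter (c s) = real (w n)" "letter (c t) = real (w n)"
    proof -
      have a: "2 * pi * of_int n \<le> \<theta> s" "\<theta> s < 2 * pi * (of_int n + 1)"
        using s x x' by (simp_all add: algebra_simps)
      have b: "2 * pi * of_int n \<le> \<theta> t" "\<theta> t < 2 * pi * (of_int n + 1)"
        using s xy y x by (simp_all add: algebra_simps)
      show "letter (c s) = real (w n)" "letter (c t) = real (w n)"
        using mono_curve_point[OF r a] mono_curve_point[OF r b] \<open>cos x < 0\<close> \<open>cos y < 0\<close> cs by auto
    qed
    ultimately have "cross (c s) (c t) = [(w n, True)]"
      using right[of s] right[of t] up[of s] up[of t] by (auto simp: cross_def cs)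
    then show ?thesis using nt'[OF y] by (simp add: n_def[symmetric] pos_def)
  next
    case True
    have "cross (c s) (c t) = []"
    proof (cases "cos x < 0 \<and> cos y < 0")
      case False
      then show ?thesis using right[of s] right[of t] by (auto simp: cross_def cs)
    next
      case neg: True
      then have "\<not> (- (pi/2) \<le> x \<and> x \<le> pi/2)" "\<not> (- (pi/2) \<le> y \<and> y \<le> pi/2)"
        using cos_ge_zero[of x] cos_ge_zero[of y] by auto
      then consider "pi/2 < x" | "x < - (pi/2)" "y < - (pi/2)" using xy by linarith
      then have "0 < sin x \<longleftrightarrow> 0 < sin y"
      proof cases
        case 1
        then have "0 < sin x" "0 < sin y" using x xy True by (auto intro!: sin_gt_zero)
        then show ?thesis by simp
      next
        case 2
        then have "\<not> 0 < sin x" "\<not> 0 < sin y" using sin_ge_zero[of "- x"] sin_ge_zero[of "- y"] x xy by auto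
        then show ?thesis by simp
      qed
      then have "Im (c s) < 0 \<longleftrightarrow> Im (c t) < 0" using up[of s] up[of t] cs by simp
      then show ?thesis by (auto simp: cross_def)
    qed
    then show ?thesis using nt[OF True] by (simp add: n_def[symmetric] pos_def)
  qed
qed

abbreviation segment_path :: "(real \<Rightarrow> complex) \<Rightarrow> real \<Rightarrow> real \<Rightarrow> real \<Rightarrow> complex" where
  "segment_path c s t \<equiv> \<lambda>u. c (s + (t - s) * u)"

lemma pos_append: "pos (u @ v) = pos u @ pos v" by (simp add: pos_def)

text \<open>Samples record antipodes, whereas letters are delimited by the wedge point. Starting and
  ending at multiples of 2 pi makes the two counts agree, so that no letter is cut.\<close>

lemma samples_mono_curve:
  assumes c: "mono_curve k c \<theta>" and r: "reads k c \<theta> w" and st: "s < t"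
    and a: "\<theta> s = 2 * pi * of_int a" and b: "\<theta> t = 2 * pi * of_int b"
  shows "\<exists>N0>0. \<forall>N\<ge>N0. samples (segment_path c s t) N = pos (map w [a..b - 1])"
proof -
  let ?\<theta> = "\<lambda>u. \<theta> (s + (t - s) * u)"
  have th: "continuous_on UNIV \<theta>" "strict_mono \<theta>" using c by (auto simp: mono_curve_def)
  have "uniformly_continuous_on {0..1} ?\<theta>"
    using th(1) by (intro compact_uniformly_continuous continuous_on_compose2[OF th(1)] continuous_intros) auto
  moreover have e: "pi / 4 > 0" by simp
  ultimately obtain \<delta> where d: "\<delta> > 0" "\<And>u v. u \<in> {0..1} \<Longrightarrow> v \<in> {0..1} \<Longrightarrow> dist u v < \<delta> \<Longrightarrow> dist (?\<theta> u) (?\<theta> v) < pi / 4"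
    using e unfolding uniformly_continuous_on_def by meson
  obtain N0 :: nat where N0: "N0 > 0" "1 / real N0 < \<delta>"
    using d(1) by (metis nat_approx_posE zero_less_Suc)
  have "samples (segment_path c s t) N = pos (map w [a..b - 1])" if N: "N \<ge> N0" for N
  proof -
    have Np: "N > 0" using N N0 by simp
    have dN: "1 / real N < \<delta>"
    proof -
      have "1 / real N \<le> 1 / real N0" using N N0 by (simp add: field_simps)
      then show ?thesis using N0 by simp
    qed
    let ?u = "\<lambda>i::nat. s + (t - s) * (real i / real N)"
    define M where "M = (\<lambda>u. \<lfloor>(\<theta> u + pi) / (2 * pi)\<rfloor>)"
    have "a \<le> M (?u i) \<and> crossings (\<lambda>i. c (?u i)) i = pos (map w [a..M (?u i) - 1])" if "i \<le> N" for i
      using that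
    proof (induction i)
      case 0
      have "M s = a" unfolding M_def a by (intro floor_unique) (simp_all add: field_simps)
      then show ?case by (simp add: pos_def)
    next
      case (Suc i)
      have "?u i < ?u (Suc i)" using st Np by (simp add: divide_strict_right_mono)
      then have lt: "\<theta> (?u i) < \<theta> (?u (Suc i))" using th(2) by (simp add: strict_mono_def)
      have "dist (real i / real N) (real (Suc i) / real N) = 1 / real N"
        by (simp add: dist_real_def flip: diff_divide_distrib)
      then have "dist (\<theta> (?u i)) (\<theta> (?u (Suc i))) < pi / 4"
        using Suc.prems Np dN by (intro d(2)) auto
      then have lt': "\<theta> (?u (Suc i)) < \<theta> (?u i) + pi / 4" using lt by (simp add: dist_real_def)
      have cr: "M (?u (Suc i)) \<in> {M (?u i), M (?u i) + 1}"
          "cross (c (?u i)) (c (?u (Suc i))) = pos (map w [M (?u i)..M (?u (Suc i)) - 1])"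
        unfolding M_def by (rule cross_mono_curve[OF r less_imp_le[OF lt] lt'])+
      have IH: "a \<le> M (?u i)" "crossings (\<lambda>i. c (?u i)) i = pos (map w [a..M (?u i) - 1])"
        using Suc by auto
      have M: "M (?u (Suc i)) = M (?u i) \<or> M (?u (Suc i)) = M (?u i) + 1" using cr(1) by blast
      have "[a..M (?u i) - 1] @ [M (?u i)..M (?u (Suc i)) - 1] = [a..M (?u (Suc i)) - 1]"
        using M
      proof
        assume "M (?u (Suc i)) = M (?u i) + 1"
        then show ?thesis using upto_rec2[of a "M (?u i)"] IH(1) by simp
      qed simp
      then show ?case using IH cr(2) M by (auto simp: crossings_Suc simp flip: pos_append map_append)
    qed
    from this[of N] have "crossings (\<lambda>i. c (?u i)) N = pos (map w [a..M t - 1])" using Np by simp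
    moreover have "M t = b" unfolding M_def b by (intro floor_unique) (simp_all add: field_simps)
    ultimately show ?thesis by simp
  qed
  then show ?thesis using N0(1) by blast
qed

text \<open>The bound n on the disturbed letters at either end and the shift d precede the
  quantifiers over curves: one pair has to serve arbitrarily long segments.\<close>

definition matching_words ::
  "nat \<Rightarrow> complex set \<Rightarrow> complex \<Rightarrow> (complex \<Rightarrow> complex) \<Rightarrow> (complex \<Rightarrow> complex) \<Rightarrow> int \<Rightarrow> int \<Rightarrow> bool" where
  "matching_words k T v f g n d \<longleftrightarrow> (\<forall>\<gamma> s t \<theta> \<theta>' w w' a b a' b'.
     s < t \<longrightarrow> loop_at T v (segment_path \<gamma> s t) \<longrightarrow>
     mono_curve k (\<lambda>t. f (\<gamma> t)) \<theta> \<longrightarrow> reads k (\<lambda>t. f (\<gamma> t)) \<theta> w \<longrightarrow>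
     \<theta> s = 2 * pi * of_int a \<longrightarrow> \<theta> t = 2 * pi * of_int b \<longrightarrow>
     mono_curve k (\<lambda>t. g (\<gamma> t)) \<theta>' \<longrightarrow> reads k (\<lambda>t. g (\<gamma> t)) \<theta>' w' \<longrightarrow>
     \<theta>' s = 2 * pi * of_int a' \<longrightarrow> \<theta>' t = 2 * pi * of_int b' \<longrightarrow>
     b - a = b' - a' \<and> (\<forall>p. n \<le> p \<longrightarrow> p + n < b - a \<longrightarrow> w (a + p) = w' (a' + p - d)))"

lemma conjugate_loops_words:
  assumes conj: "pi1_conj_by (wedge k) 0 T v \<alpha> g f" and k: "1 \<le> k"
  shows "\<exists>n d. matching_words k T v f g n d"
proof -
  have al: "path \<alpha>" "path_image \<alpha> \<subseteq> wedge k" "pathstart \<alpha> = 0" "pathfinish \<alpha> = 0"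
    using conj by (auto simp: pi1_conj_by_def loop_at_def)
  obtain A where A: "A > 0" "\<And>N K. N \<ge> A \<Longrightarrow> K > 0 \<Longrightarrow> acts (samples \<alpha> (N * K)) = acts (samples \<alpha> N)"
    using samples_refine[OF al(1,2) k] by blast
  \<comment> \<open>Fixed before any loop is given: its length bounds the disturbed ends and its
    exponent sum is the shift.\<close>
  define ls where "ls = samples \<alpha> A"
  have main: "b - a = b' - a' \<and> (\<forall>p. int (length ls) \<le> p \<longrightarrow> p + int (length ls) < b - a \<longrightarrow> w (a + p) = w' (a' + p - deg ls))"
    if st: "s < t" and loop: "loop_at T v (segment_path \<gamma> s t)"
      and cf: "mono_curve k (\<lambda>t. f (\<gamma> t)) \<theta>" "reads k (\<lambda>t. f (\<gamma> t)) \<theta> w" "\<theta> s = 2 * pi * of_int a" "\<theta> t = 2 * pi * of_int b"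
      and cg: "mono_curve k (\<lambda>t. g (\<gamma> t)) \<theta>'" "reads k (\<lambda>t. g (\<gamma> t)) \<theta>' w'" "\<theta>' s = 2 * pi * of_int a'" "\<theta>' t = 2 * pi * of_int b'"
    for \<gamma> s t \<theta> \<theta>' w w' a b a' b'
  proof -
    let ?F = "\<lambda>u. f (segment_path \<gamma> s t u)" and ?G = "\<lambda>u. g (segment_path \<gamma> s t u)"
    have "homotopic_paths (wedge k) ?G (reversepath \<alpha> +++ (?F +++ \<alpha>))"
      using conj loop by (auto simp: pi1_conj_by_def comp_def)
    note hG = this
    have lt: "\<theta> s < \<theta> t" "\<theta>' s < \<theta>' t" using cf(1) cg(1) st by (auto simp: mono_curve_def strict_mono_def)
    have ab: "a < b" "a' < b'" using lt unfolding cf(3,4) cg(3,4) by simp_all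
    have c0: "cis (2 * pi * of_int m) = 1" for m :: int by (auto simp: cis_eq_1_iff)
    have z: "f (\<gamma> s) = 0" "f (\<gamma> t) = 0" "g (\<gamma> s) = 0" "g (\<gamma> t) = 0"
      using cf(2)[unfolded reads_def, rule_format, of a s] cf(2)[unfolded reads_def, rule_format, of b t]
        cg(2)[unfolded reads_def, rule_format, of a' s] cg(2)[unfolded reads_def, rule_format, of b' t]
        cf cg c0[of a] c0[of b] c0[of a'] c0[of b'] by (auto simp: circ_eq_0_iff)
    have ends: "pathstart ?F = 0" "pathfinish ?F = 0" "pathstart ?G = 0" "pathfinish ?G = 0"
      using z by (auto simp: pathstart_def pathfinish_def)
    have pF: "path ?F" "path_image ?F \<subseteq> wedge k"
    proof -
      have "continuous_on UNIV (\<lambda>t. f (\<gamma> t))" using cf by (simp add: mono_curve_def)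
      then show "path ?F" unfolding path_def
        by (rule continuous_on_compose2[where g = "\<lambda>t. f (\<gamma> t)"]) (auto intro!: continuous_intros)
      show "path_image ?F \<subseteq> wedge k" using cf by (auto simp: mono_curve_def path_image_def)
    qed
    \<comment> \<open>Moving the inverse of \<alpha> to the other side leaves only forward copies of
      \<alpha> to be sampled, and gives the equation \<open>conjugate_positive_words\<close>
      expects.\<close>
    have "homotopic_paths (wedge k) (\<alpha> +++ ?G) (\<alpha> +++ (reversepath \<alpha> +++ (?F +++ \<alpha>)))"
      using hG al ends by (intro homotopic_paths_join) auto
    also have "homotopic_paths (wedge k) \<dots> ((\<alpha> +++ reversepath \<alpha>) +++ (?F +++ \<alpha>))"
      using al pF ends by (intro homotopic_paths_assoc) (auto simp: path_image_join)
    also have "homotopic_paths (wedge k) \<dots> (linepath 0 0 +++ (?F +++ \<alpha>))"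
      using al pF ends homotopic_paths_rinv[OF al(1,2)]
      by (intro homotopic_paths_join) (auto simp: path_image_join)
    also have "homotopic_paths (wedge k) \<dots> (?F +++ \<alpha>)"
      using al pF ends homotopic_paths_lid[of "?F +++ \<alpha>" "wedge k"] by (auto simp: path_image_join)
    finally have "homotopic_paths (wedge k) (\<alpha> +++ ?G) (?F +++ \<alpha>)" .
    from samples_homotopic[OF this k] obtain N1 where N1: "\<And>N. N \<ge> N1 \<Longrightarrow> acts (samples (\<alpha> +++ ?G) N) = acts (samples (?F +++ \<alpha>) N)"
      by blast
    obtain N2 where N2: "\<And>N. N \<ge> N2 \<Longrightarrow> samples ?F N = pos (map w [a..b - 1])"
      using samples_mono_curve[OF cf(1,2) st cf(3,4)] by blast
    obtain N3 where N3: "\<And>N. N \<ge> N3 \<Longrightarrow> samples ?G N = pos (map w' [a'..b' - 1])"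
      using samples_mono_curve[OF cg(1,2) st cg(3,4)] by blast
    define K where "K = Suc (N1 + N2 + N3)"
    \<comment> \<open>A multiple of A, so that \<alpha> still acts as \<open>ls\<close>, and fine
      enough for the homotopy and for both curves.\<close>
    define N where "N = A * K"
    have "1 * K \<le> N" unfolding N_def using A(1) by (intro mult_le_mono1) simp
    then have "K \<le> N" "0 < N" by (auto simp: K_def)
    then have ge: "N \<ge> N1" "N \<ge> N2" "N \<ge> N3" "2 * N \<ge> N1" by (auto simp: K_def)
    have al_N: "acts (samples \<alpha> N) = acts ls" using A(2)[of A K] by (simp add: N_def ls_def K_def)
    have "acts (samples \<alpha> N @ samples ?G N) = acts (samples ?F N @ samples \<alpha> N)"
      using N1[OF ge(4)] samples_join[OF \<open>0 < N\<close>, of \<alpha> ?G] samples_join[OF \<open>0 < N\<close>, of ?F \<alpha>] al ends by simp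
    then have eq: "acts ls (acts (pos (map w' [a'..b' - 1])) []) = acts (pos (map w [a..b - 1])) (acts ls [])"
      using N2 N3 ge al_N by (simp add: fun_eq_iff)
    note W = conjugate_positive_words[OF eq]
    have len: "b - a = b' - a'" using W(1) ab by simp
    have "w (a + p) = w' (a' + p - deg ls)" if p: "int (length ls) \<le> p" "p + int (length ls) < b - a" for p
    proof -
      define q where "q = nat p"
      have q: "p = int q" "length ls \<le> q" "q + length ls < length (map w [a..b - 1])" using p by (auto simp: q_def)
      note X = W(2)[OF q(2,3)]
      have "w (a + p) = map w [a..b - 1] ! q" using q by simp
      also have "\<dots> = map w' [a'..b' - 1] ! nat (int q - deg ls)" using X by simp
      also have "\<dots> = w' ([a'..b' - 1] ! nat (int q - deg ls))" using X ab by (intro nth_map) auto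
      also have "[a'..b' - 1] ! nat (int q - deg ls) = a' + (int q - deg ls)"
        using X ab by (subst nth_upto) auto
      finally show ?thesis using q by (simp add: algebra_simps)
    qed
    with len show ?thesis by blast
  qed
  show ?thesis unfolding matching_words_def
    by (intro exI allI impI) (rule main, assumption+)
qed

section \<open>Conjugate positive maps\<close>

lemma mono_curve_shift:
  assumes "mono_curve k c \<theta>"
  shows "mono_curve k c (\<lambda>t. \<theta> t - 2 * pi * of_int m)"
proof -
  have "cis (\<theta> t - 2 * pi * of_int m) = cis (\<theta> t)" for t
    by (auto simp: cis_eq_iff intro: exI[of _ "- m"])
  then show ?thesis using assms
    by (auto simp: mono_curve_def strict_mono_def intro!: continuous_intros)
qed

lemma wedge_param:
  assumes "z \<in> wedge k"
  shows "\<exists>j\<in>{1..k}. \<exists>s\<in>{0..2 * pi}. z = circ j s"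
proof -
  obtain j s where js: "j \<in> {1..k}" "z = circ j s" using assms by (auto simp: wedge_iff)
  let ?n = "\<lfloor>s / (2 * pi)\<rfloor>"
  have "s - 2 * pi * of_int ?n \<in> {0..2 * pi}"
    using floor_divide_lower[of "2 * pi" s] floor_divide_upper[of "2 * pi" s] by (simp add: algebra_simps)
  moreover have "cis (s - 2 * pi * of_int ?n) = cis s"
    unfolding cis_eq_iff by (intro exI[of _ "- ?n"]) simp
  ultimately show ?thesis using js circ_cong by metis
qed

lemma circ_inj:
  assumes "circ i s = circ j t" "circ i s \<noteq> 0" "1 \<le> i" "1 \<le> j" "s \<in> {0..2 * pi}" "t \<in> {0..2 * pi}"
  shows "i = j \<and> s = t"
proof
  have "real i = real j" using letter_circ assms by metis
  then show "i = j" by simp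
  have "cis s = cis t" using assms phase_circ by metis
  then obtain n :: int where n: "s = t + 2 * pi * of_int n" using cis_eq_iff by blast
  have "cis s \<noteq> 1" using assms(2) by (simp only: circ_eq_0_iff) simp
  then have "s \<noteq> 0" "s \<noteq> 2 * pi" by (auto simp: complex_eq_iff)
  then have "0 < s" "s < 2 * pi" using assms(5) by auto
  then have a: "2 * pi * of_int n < 2 * pi * 1" "2 * pi * (- 1) < 2 * pi * of_int n"
    using n assms(6) unfolding atLeastAtMost_iff by linarith+
  have "0 < 2 * pi" by simp
  note a[unfolded mult_less_cancel_left_pos[OF this]]
  then have "n = 0" by linarith
  then show "s = t" using n by simp
qed

lemma circle_curve_normalized:
  assumes f: "positive_map k' k f" and j: "j \<in> {1..k'}"
  obtains \<Theta> b where "mono_curve k (\<lambda>s. f (circ j s)) \<Theta>" "\<Theta> 0 = 0" "\<Theta> (2 * pi) = 2 * pi * of_int b"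
proof -
  obtain \<Theta> where \<Theta>: "mono_curve k (\<lambda>s. f (circ j s)) \<Theta>" using positive_map_circ_curve[OF f j] .
  have f0: "f 0 = 0" using f by (simp add: positive_map_def)
  have "circ j (2 * pi) = 0" by (simp add: circ_cis complex_eq_iff)
  then have "cis (\<Theta> 0) = 1" "cis (\<Theta> (2 * pi)) = 1"
    using \<Theta> f0 unfolding mono_curve_def by (metis circ_0 phase_0)+
  then obtain a b :: int where ab: "\<Theta> 0 = 2 * pi * of_int a" "\<Theta> (2 * pi) = 2 * pi * of_int b"
    using cis_eq_1_iff by meson
  show ?thesis
    by (rule that[OF mono_curve_shift[OF \<Theta>, of a], of "b - a"]) (simp_all only: ab of_int_diff right_diff_distrib diff_self)
qed

text \<open>Conjugate positive words have equal length, so on each circle the lifts for f and g that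
  start at 0 also end at the same value. Their difference vanishes at both ends and therefore
  descends to the wedge.\<close>

lemma conjugate_phase_difference:
  assumes f: "positive_map k' k f" and g: "positive_map k' k g" and k: "1 \<le> k" "1 \<le> k'"
    and conj: "pi1_conj_by (wedge k) 0 (wedge k') 0 \<alpha> g f"
  shows "\<exists>\<Delta>. continuous_on (wedge k') \<Delta> \<and> \<Delta> 0 = 0 \<and>
    (\<forall>z\<in>wedge k'. phase (g z) = phase (f z) * cis (\<Delta> z))"
proof -
  have "\<exists>D. continuous_on UNIV D \<and> D 0 = 0 \<and> D (2 * pi) = 0 \<and>
      (\<forall>s. phase (g (circ j s)) = phase (f (circ j s)) * cis (D s))" if j: "j \<in> {1..k'}" for j
  proof -
    obtain F b where F: "mono_curve k (\<lambda>s. f (circ j s)) F" "F 0 = 0" "F (2 * pi) = 2 * pi * of_int b"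
      using circle_curve_normalized[OF f j] .
    obtain G b' where G: "mono_curve k (\<lambda>s. g (circ j s)) G" "G 0 = 0" "G (2 * pi) = 2 * pi * of_int b'"
      using circle_curve_normalized[OF g j] .
    obtain w w' where w: "reads k (\<lambda>s. f (circ j s)) F w" "reads k (\<lambda>s. g (circ j s)) G w'"
      using mono_curve_reads[OF F(1) k(1)] mono_curve_reads[OF G(1) k(1)] by blast
    have "circ j (2 * pi) = 0" by (simp add: circ_cis complex_eq_iff)
    then have loop: "loop_at (wedge k') 0 (segment_path (circ j) 0 (2 * pi))"
      using circ_in_wedge[OF j] unfolding loop_at_def path_def
      by (auto simp: pathstart_def pathfinish_def path_image_def
          intro!: continuous_on_compose2[OF continuous_on_circ[of UNIV j]] continuous_intros)
    obtain n d where *: "matching_words k (wedge k') 0 f g n d"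
      using conjugate_loops_words[OF conj k(1)] by blast
    have "b - 0 = b' - 0 \<and> (\<forall>p. n \<le> p \<longrightarrow> p + n < b - 0 \<longrightarrow> w (0 + p) = w' (0 + p - d))"
      by (rule *[unfolded matching_words_def, rule_format, OF _ loop F(1) w(1) _ F(3) G(1) w(2) _ G(3)])
        (simp_all add: F G)
    then have "b = b'" by simp
    then show ?thesis
      using F G by (intro exI[of _ "\<lambda>s. G s - F s"])
        (auto simp: mono_curve_def cis_mult intro!: continuous_intros)
  qed
  then obtain D where D: "\<And>j. j \<in> {1..k'} \<Longrightarrow> continuous_on UNIV (D j)" "\<And>j. j \<in> {1..k'} \<Longrightarrow> D j 0 = 0"
      "\<And>j. j \<in> {1..k'} \<Longrightarrow> D j (2 * pi) = 0"
      "\<And>j s. j \<in> {1..k'} \<Longrightarrow> phase (g (circ j s)) = phase (f (circ j s)) * cis (D j s)"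
    by metis
  \<comment> \<open>Within one period a point has several parameters only if it is the wedge point,
    where all \<open>D j\<close> vanish; so the choice does not matter.\<close>
  define \<Delta> where "\<Delta> z = (SOME y. \<exists>j\<in>{1..k'}. \<exists>s\<in>{0..2*pi}. z = circ j s \<and> y = D j s)" for z
  have circ_zero: "s = 0 \<or> s = 2 * pi" if "circ j s = 0" "j \<in> {1..k'}" "s \<in> {0..2 * pi}" for j s
  proof -
    have "cis s = 1" using that by (auto simp: circ_eq_0_iff)
    then obtain n :: int where n: "s = 2 * pi * of_int n" unfolding cis_eq_1_iff by blast
    have a: "2 * pi * 0 \<le> 2 * pi * of_int n" "2 * pi * of_int n \<le> 2 * pi * 1" using that(3) by (auto simp: n)
    have "0 < 2 * pi" by simp
    note a[unfolded mult_le_cancel_left_pos[OF this]]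
    then have "0 \<le> n" "n \<le> 1" by linarith+
    then show ?thesis using n by (cases "n = 0") auto
  qed
  have \<Delta>: "\<Delta> (circ j s) = D j s" if js: "j \<in> {1..k'}" "s \<in> {0..2 * pi}" for j s
    unfolding \<Delta>_def
  proof (rule some_equality)
    show "\<exists>i\<in>{1..k'}. \<exists>t\<in>{0..2*pi}. circ j s = circ i t \<and> D j s = D i t" using js by blast
    fix y assume "\<exists>i\<in>{1..k'}. \<exists>t\<in>{0..2*pi}. circ j s = circ i t \<and> y = D i t"
    then obtain i t where it: "i \<in> {1..k'}" "t \<in> {0..2*pi}" "circ j s = circ i t" "y = D i t" by blast
    show "y = D j s"
    proof (cases "circ j s = 0")
      case True
      then show ?thesis using circ_zero[of j s] circ_zero[of i t] it js D(2,3) by auto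
    next
      case False
      then show ?thesis using circ_inj[of j s i t] it js by auto
    qed
  qed
  have comp: "compact (circ j ` ({0..2 * pi} \<inter> D j -` B))" if "j \<in> {1..k'}" "closed B" for j B
  proof -
    have "closed (D j -` B)" using D(1)[OF that(1)] that(2) continuous_on_closed_vimage[of UNIV "D j"] by simp
    then have "compact ({0..2 * pi} \<inter> D j -` B)" by (intro compact_Int_closed) auto
    then show ?thesis by (intro compact_continuous_image continuous_on_circ)
  qed
  \<comment> \<open>Preimages of closed sets become finite unions of images of compact sets, which
    settles continuity without a separate argument at the wedge point.\<close>
  have pre: "\<Delta> -` B \<inter> wedge k' = (\<Union>j\<in>{1..k'}. circ j ` ({0..2 * pi} \<inter> D j -` B))" for B
  proof (intro equalityI subsetI)
    fix z assume z: "z \<in> \<Delta> -` B \<inter> wedge k'"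
    then obtain j s where js: "j \<in> {1..k'}" "s \<in> {0..2 * pi}" "z = circ j s" using wedge_param by blast
    then have "s \<in> {0..2 * pi} \<inter> D j -` B" using z \<Delta>[OF js(1,2)] by simp
    then show "z \<in> (\<Union>j\<in>{1..k'}. circ j ` ({0..2 * pi} \<inter> D j -` B))" using js by blast
  next
    fix z assume "z \<in> (\<Union>j\<in>{1..k'}. circ j ` ({0..2 * pi} \<inter> D j -` B))"
    then obtain j s where "j \<in> {1..k'}" "s \<in> {0..2 * pi}" "D j s \<in> B" "z = circ j s" by blast
    then show "z \<in> \<Delta> -` B \<inter> wedge k'" using \<Delta>[of j s] circ_in_wedge[of j k' s] by simp
  qed
  have cl: "closed (\<Delta> -` B \<inter> wedge k')" if "closed B" for B
    unfolding pre using comp[OF _ that] by (intro compact_imp_closed compact_UN) auto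
  have "closed (wedge k')" using cl[of UNIV] by simp
  then have "continuous_on (wedge k') \<Delta>" using cl by (simp add: continuous_on_closed_vimage)
  moreover have "\<Delta> 0 = 0" using \<Delta>[of 1 0] D(2)[of 1] k by simp
  moreover have "phase (g z) = phase (f z) * cis (\<Delta> z)" if "z \<in> wedge k'" for z
    using wedge_param[OF that] \<Delta> D(4) by auto
  ultimately show ?thesis by blast
qed

text \<open>Any given letter lies deep inside a sufficiently long loop cut out of \<gamma> at the
  wedge point, so the disturbed ends can be pushed away and the two words agree everywhere up to d.
  The lifts \<theta> and \<theta> + \<Delta> number these loops alike because \<Delta> vanishes at
  the wedge point.\<close>

lemma conjugate_curves_agree:
  assumes f: "positive_map k' k f" and g: "positive_map k' k g" and k: "1 \<le> k" "1 \<le> k'"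
    and conj: "pi1_conj_by (wedge k) 0 (wedge k') 0 \<alpha> g f"
    and \<Delta>: "continuous_on (wedge k') \<Delta>" "\<Delta> 0 = 0"
      "\<And>z. z \<in> wedge k' \<Longrightarrow> phase (g z) = phase (f z) * cis (\<Delta> z)"
  shows "\<exists>d::int. \<forall>\<gamma> \<eta> \<theta> s t. mono_curve k' \<gamma> \<eta> \<longrightarrow> surj \<eta> \<longrightarrow> continuous_on UNIV \<theta> \<longrightarrow>
    (\<forall>t. phase (f (\<gamma> t)) = cis (\<theta> t)) \<longrightarrow> \<theta> s + \<Delta> (\<gamma> s) = \<theta> t - 2 * pi * of_int d \<longrightarrow> g (\<gamma> s) = f (\<gamma> t)"
proof -
  obtain n d where *: "matching_words k (wedge k') 0 f g n d"
      using conjugate_loops_words[OF conj k(1)] by blast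
  have "g (\<gamma> s) = f (\<gamma> t)" if \<gamma>: "mono_curve k' \<gamma> \<eta>" and \<eta>: "surj \<eta>" and \<theta>: "continuous_on UNIV \<theta>"
    and lift: "\<And>t. phase (f (\<gamma> t)) = cis (\<theta> t)" and st: "\<theta> s + \<Delta> (\<gamma> s) = \<theta> t - 2 * pi * of_int d"
    for \<gamma> \<eta> \<theta> s t
  proof -
    have c: "continuous_on UNIV \<gamma>" "\<And>t. \<gamma> t \<in> wedge k'" "strict_mono \<eta>" "\<And>t. phase (\<gamma> t) = cis (\<eta> t)"
      using \<gamma> by (auto simp: mono_curve_def)
    define \<theta>' where "\<theta>' u = \<theta> u + \<Delta> (\<gamma> u)" for u
    have "continuous_on UNIV (\<lambda>u. \<Delta> (\<gamma> u))"
      using c by (intro continuous_on_compose2[OF \<Delta>(1)]) auto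
    then have \<theta>': "continuous_on UNIV \<theta>'" unfolding \<theta>'_def using \<theta> by (intro continuous_intros)
    have lift': "phase (g (\<gamma> t)) = cis (\<theta>' t)" for t
      using \<Delta>(3)[OF c(2)] lift by (simp add: \<theta>'_def cis_mult)
    have F: "mono_curve k (\<lambda>t. f (\<gamma> t)) \<theta>" using positive_map_mono_curve[OF f k(2) \<gamma> \<theta> lift] .
    have G: "mono_curve k (\<lambda>t. g (\<gamma> t)) \<theta>'" using positive_map_mono_curve[OF g k(2) \<gamma> \<theta>' lift'] .
    obtain w w' where w: "reads k (\<lambda>t. f (\<gamma> t)) \<theta> w" "reads k (\<lambda>t. g (\<gamma> t)) \<theta>' w'"
      using mono_curve_reads[OF F k(1)] mono_curve_reads[OF G k(1)] by blast
    \<comment> \<open>Times at which \<gamma> is at the wedge point; surjectivity of \<eta> provides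
      one for every m.\<close>
    define u where "u m = inv \<eta> (2 * pi * of_int m)" for m :: int
    have u: "\<eta> (u m) = 2 * pi * of_int m" for m unfolding u_def using \<eta> by (rule surj_f_inv_f)
    have u0: "\<gamma> (u m) = 0" for m
    proof -
      have "cis (\<eta> (u m)) = 1" unfolding u cis_eq_1_iff by blast
      moreover obtain j where "\<gamma> (u m) = circ j (\<eta> (u m))"
        using wedge_point_eq[OF c(2)[of "u m"] c(4)] by blast
      ultimately show ?thesis by (simp add: circ_eq_0_iff)
    qed
    have "\<exists>e::int. \<theta> (u m) = 2 * pi * of_int e" for m
    proof -
      have "cis (\<theta> (u m)) = 1" using lift[of "u m"] f by (simp add: u0 positive_map_def)
      then show ?thesis by (simp only: cis_eq_1_iff)
    qed
    then obtain e :: "int \<Rightarrow> int" where e: "\<And>m. \<theta> (u m) = 2 * pi * of_int (e m)" by metis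
    have u_less: "u i < u j" if "i < j" for i j
    proof -
      have "\<eta> (u i) < \<eta> (u j)" unfolding u using that by simp
      then show ?thesis using c(3) by (simp add: strict_mono_less)
    qed
    have e_less: "e i < e j" if "i < j" for i j
    proof -
      have "\<theta> (u i) < \<theta> (u j)" using F u_less[OF that] by (simp add: mono_curve_def strict_mono_def)
      then show ?thesis unfolding e by simp
    qed
    \<comment> \<open>Between consecutive times \<open>u\<close> the f-image completes at least one
      letter, so the ends of the loops recede at least linearly.\<close>
    have e_bd: "e 0 + int N \<le> e (int N) \<and> e (- int N) \<le> e 0 - int N" for N
    proof (induction N)
      case (Suc N)
      have "e (int N) < e (int (Suc N))" "e (- int (Suc N)) < e (- int N)" by (intro e_less; simp)+
      then show ?case using Suc by simp
    qed simp
    define m where "m = \<lfloor>\<theta> t / (2 * pi)\<rfloor>"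
    have m: "2 * pi * of_int m \<le> \<theta> t" "\<theta> t \<le> 2 * pi * (of_int m + 1)"
      using floor_divide_lower[of "2 * pi" "\<theta> t"] floor_divide_upper[of "2 * pi" "\<theta> t"] unfolding m_def
      by (simp_all add: mult.commute)
    \<comment> \<open>Large enough that letter m is more than n letters away from both ends.\<close>
    define N where "N = Suc (nat (\<bar>m\<bar> + \<bar>e 0\<bar> + \<bar>n\<bar>))"
    let ?s = "u (- int N)" and ?t = "u (int N)" and ?a = "e (- int N)" and ?b = "e (int N)"
    have less: "?s < ?t" by (rule u_less) (simp add: N_def)
    have loop: "loop_at (wedge k') 0 (segment_path \<gamma> ?s ?t)"
      unfolding loop_at_def path_def
    proof (intro conjI)
      show "continuous_on {0..1} (segment_path \<gamma> ?s ?t)"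
        by (intro continuous_on_compose2[OF c(1)] continuous_intros) auto
      show "path_image (segment_path \<gamma> ?s ?t) \<subseteq> wedge k'" using c(2) by (auto simp: path_image_def)
    qed (simp_all add: pathstart_def pathfinish_def u0)
    have ends: "\<theta>' ?s = 2 * pi * of_int ?a" "\<theta>' ?t = 2 * pi * of_int ?b"
      by (simp_all add: \<theta>'_def u0 \<Delta>(2) e)
    have "int N = 1 + \<bar>m\<bar> + \<bar>e 0\<bar> + \<bar>n\<bar>" by (simp add: N_def)
    then have "n \<le> m - ?a" "m - ?a + n < ?b - ?a" using e_bd[of N] by linarith+
    moreover have "\<forall>p. n \<le> p \<longrightarrow> p + n < ?b - ?a \<longrightarrow> w (?a + p) = w' (?a + p - d)"
      using *[unfolded matching_words_def, rule_format, OF less loop F w(1) e e G w(2) ends] by blast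
    ultimately have "w (?a + (m - ?a)) = w' (?a + (m - ?a) - d)" by blast
    then have ww: "w m = w' (m - d)" by simp
    have s: "\<theta>' s = \<theta> t - 2 * pi * of_int d" using st by (simp add: \<theta>'_def)
    have "2 * pi * of_int (m - d) \<le> \<theta>' s" "\<theta>' s \<le> 2 * pi * (of_int (m - d) + 1)"
      using m unfolding s by (simp_all add: algebra_simps)
    then have "g (\<gamma> s) = circ (w' (m - d)) (\<theta>' s)" using w(2) unfolding reads_def by blast
    also have "\<dots> = circ (w m) (\<theta> t)"
      unfolding ww s cis_eq_iff by (intro circ_cong, unfold cis_eq_iff) (intro exI[of _ "- d"], simp)
    also have "\<dots> = f (\<gamma> t)" using w(1) m unfolding reads_def by metis
    finally show ?thesis .
  qed
  then show ?thesis by blast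
qed

section \<open>Phase cocycles of a flow\<close>

text \<open>With increasing sections, \<open>a < \<tau> x\<close> means \<open>M x a < c\<close>,
  which is an open condition on x; upper bounds are alike.\<close>

lemma implicit_solution:
  fixes M :: "'a::metric_space \<Rightarrow> real \<Rightarrow> real"
  assumes cont: "continuous_on (K \<times> UNIV) (\<lambda>(x, t). M x t)"
    and mono: "\<And>x. x \<in> K \<Longrightarrow> strict_mono (M x)" and "\<And>x. x \<in> K \<Longrightarrow> surj (M x)"
  shows "\<exists>\<tau>. continuous_on K \<tau> \<and> (\<forall>x\<in>K. M x (\<tau> x) = c)"
proof -
  have "\<forall>x\<in>K. \<exists>t. M x t = c" using assms(3) by (metis surjD)
  then obtain \<tau> where \<tau>: "\<And>x. x \<in> K \<Longrightarrow> M x (\<tau> x) = c" by metis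
  have sec: "continuous_on K (\<lambda>x. M x t)" for t
  proof -
    have "continuous_on K (\<lambda>x. (\<lambda>(x, t). M x t) (x, t))"
      by (intro continuous_on_compose2[OF cont] continuous_intros) auto
    then show ?thesis by simp
  qed
  have "continuous_on K \<tau>"
    unfolding continuous_on_def
  proof
    fix x assume x: "x \<in> K"
    show "(\<tau> \<longlongrightarrow> \<tau> x) (at x within K)"
    proof (rule order_tendstoI)
      fix a assume "a < \<tau> x"
      then have "M x a < c" using mono[OF x] \<tau>[OF x] by (metis strict_mono_less)
      then have "\<forall>\<^sub>F y in at x within K. M y a < c"
        using sec[of a] x by (auto simp: continuous_on_def intro: order_tendstoD)
      moreover have "\<forall>\<^sub>F y in at x within K. y \<in> K" by (simp add: eventually_at_filter)
      ultimately show "\<forall>\<^sub>F y in at x within K. a < \<tau> y"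
        by eventually_elim (metis mono \<tau> strict_mono_less)
    next
      fix a assume "\<tau> x < a"
      then have "c < M x a" using mono[OF x] \<tau>[OF x] by (metis strict_mono_less)
      then have "\<forall>\<^sub>F y in at x within K. c < M y a"
        using sec[of a] x by (auto simp: continuous_on_def intro: order_tendstoD)
      moreover have "\<forall>\<^sub>F y in at x within K. y \<in> K" by (simp add: eventually_at_filter)
      ultimately show "\<forall>\<^sub>F y in at x within K. \<tau> y < a"
        by eventually_elim (metis mono \<tau> strict_mono_less)
    qed
  qed
  then show ?thesis using \<tau> by blast
qed

lemma surj_bounded_perturbation:
  fixes M L :: "real \<Rightarrow> real"
  assumes "continuous_on UNIV M" "surj L" "\<And>t. \<bar>M t - L t\<bar> \<le> B"
  shows "surj M"
proof -
  have "\<exists>t. y = M t" for y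
  proof -
    obtain a b where ab: "L a = y - B" "L b = y + B" using assms(2) by (metis surjD)
    have "M a \<le> y" "y \<le> M b" using assms(3)[of a] assms(3)[of b] ab by auto
    moreover have "is_interval (range M)"
      using connected_continuous_image[OF assms(1)] by (simp add: is_interval_connected_1)
    ultimately have "y \<in> range M" unfolding is_interval_1 by blast
    then show ?thesis by blast
  qed
  then show ?thesis by blast
qed

text \<open>Had |d| reached e, the intermediate value theorem would give a time with |d| exactly e,
  where \<open>cis\<close> is at the excluded distance from 1. Closeness of phases thus becomes
  closeness of lifts.\<close>

lemma small_angle:
  fixes d :: "real \<Rightarrow> real"
  assumes d: "continuous_on {- T..T} d" "d 0 = 0" and e: "0 < e" "e \<le> 1"
    and small: "\<And>t. t \<in> {- T..T} \<Longrightarrow> norm (cis (d t) - 1) < norm (cis e - 1)" and t: "t \<in> {- T..T}"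
  shows "\<bar>d t\<bar> < e"
proof (rule ccontr)
  assume "\<not> \<bar>d t\<bar> < e"
  then have big: "e \<le> \<bar>d t\<bar>" by simp
  have "continuous_on {- T..T} (\<lambda>t. \<bar>d t\<bar>)" using d by (intro continuous_intros)
  then have "connected ((\<lambda>t. \<bar>d t\<bar>) ` {- T..T})" by (intro connected_continuous_image) auto
  then have "is_interval ((\<lambda>t. \<bar>d t\<bar>) ` {- T..T})" by (simp add: is_interval_connected_1)
  moreover have "\<bar>d 0\<bar> \<in> (\<lambda>t. \<bar>d t\<bar>) ` {- T..T}" "\<bar>d t\<bar> \<in> (\<lambda>t. \<bar>d t\<bar>) ` {- T..T}"
    using t by (auto intro!: imageI)
  moreover have "\<bar>d 0\<bar> \<le> e" using d e by simp
  ultimately have "e \<in> (\<lambda>t. \<bar>d t\<bar>) ` {- T..T}" using big unfolding is_interval_1 by blast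
  then obtain s where s: "s \<in> {- T..T}" "e = \<bar>d s\<bar>" by blast
  have "norm (cis (- e) - 1) = norm (cnj (cis e - 1))" by (simp add: cis_cnj)
  then have "norm (cis (- e) - 1) = norm (cis e - 1)" by (simp only: complex_mod_cnj)
  moreover have "d s = e \<or> d s = - e" using s by auto
  ultimately show False using small[OF s(1)] by auto
qed

locale compact_flow =
  fixes K :: "'a::metric_space set" and \<phi> :: "real \<Rightarrow> 'a \<Rightarrow> 'a"
  assumes compact: "compact K"
    and continuous_flow: "continuous_on (UNIV \<times> K) (\<lambda>(t, x). \<phi> t x)"
    and flow_in: "x \<in> K \<Longrightarrow> \<phi> t x \<in> K"
    and flow_0: "x \<in> K \<Longrightarrow> \<phi> 0 x = x"
    and flow_add: "x \<in> K \<Longrightarrow> \<phi> (s + t) x = \<phi> s (\<phi> t x)"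
begin

lemma continuous_on_flow:
  assumes "continuous_on S a" "continuous_on S b" "b ` S \<subseteq> K"
  shows "continuous_on S (\<lambda>u. \<phi> (a u) (b u))"
proof -
  have "continuous_on S (\<lambda>u. (\<lambda>(t, x). \<phi> t x) (a u, b u))"
    using assms by (intro continuous_on_compose2[OF continuous_flow] continuous_intros) auto
  then show ?thesis by simp
qed

text \<open>The quotient of phases along an orbit lifts from 0 because time is contractible, whether
  or not \<rho> has a logarithm on K. For joint continuity, quotients over nearby points are
  uniformly close on a bounded time window, and their lifts start together.\<close>

lemma cocycle_exists:
  fixes \<rho> :: "'a \<Rightarrow> complex"
  assumes \<rho>: "continuous_on K \<rho>" "\<And>x. norm (\<rho> x) = 1"
  shows "\<exists>L. continuous_on (K \<times> UNIV) (\<lambda>(x, t). L x t) \<and> (\<forall>x\<in>K. L x 0 = 0) \<and>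
    (\<forall>x\<in>K. \<forall>t. \<rho> (\<phi> t x) = \<rho> x * cis (L x t))"
proof -
  define F where "F x t = \<rho> (\<phi> t x) / \<rho> x" for x t
  have nz: "\<rho> x \<noteq> 0" for x using \<rho>(2)[of x] by auto
  have nF: "norm (F x t) = 1" for x t by (simp add: F_def norm_divide \<rho>(2))
  have "continuous_on (K \<times> UNIV) (\<lambda>z. \<rho> (\<phi> (snd z) (fst z)) / \<rho> (fst z))"
    using nz by (intro continuous_intros continuous_on_compose2[OF \<rho>(1)] continuous_on_flow) (auto simp: flow_in)
  then have cF: "continuous_on (K \<times> UNIV) (\<lambda>(x, t). F x t)" by (simp add: F_def case_prod_unfold)
  have "\<exists>l. continuous_on UNIV l \<and> l 0 = 0 \<and> (\<forall>t. F x t = cis (l t))" if x: "x \<in> K" for x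
  proof -
    have "continuous_on UNIV (\<lambda>t. (\<lambda>(x, t). F x t) (x, t))"
      using x by (intro continuous_on_compose2[OF cF] continuous_intros) auto
    then have "continuous_on UNIV (\<lambda>t. F x t)" by simp
    then obtain l where l: "continuous_on UNIV l" "\<And>t. F x t = cis (l t)"
      using cis_lift_exists nF by blast
    have "cis (l 0) = 1" using l(2)[of 0] nz x by (simp add: F_def flow_0)
    then have "F x t = cis (l t - l 0)" for t using l(2)[of t] by (simp add: cis_divide[symmetric])
    then show ?thesis using l by (intro exI[of _ "\<lambda>t. l t - l 0"]) (auto intro!: continuous_intros)
  qed
  then obtain L where L: "\<And>x. x \<in> K \<Longrightarrow> continuous_on UNIV (L x)" "\<And>x. x \<in> K \<Longrightarrow> L x 0 = 0"
    "\<And>x t. x \<in> K \<Longrightarrow> F x t = cis (L x t)" by metis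
  have "continuous_on (K \<times> UNIV) (\<lambda>(x, t). L x t)"
    unfolding continuous_on_iff
  proof (intro ballI allI impI)
    fix z :: "'a \<times> real" and e' :: real assume z: "z \<in> K \<times> UNIV" and e': "0 < e'"
    obtain x0 t0 where z': "z = (x0, t0)" "x0 \<in> K" using z by auto
    \<comment> \<open>The bound 1 ensures \<open>sin e \<noteq> 0\<close>, so that
      \<open>cis e\<close> differs from 1.\<close>
    define e where "e = min 1 (e' / 2)"
    have e: "0 < e" "e \<le> 1" "e \<le> e' / 2" using e' by (auto simp: e_def)
    define T where "T = \<bar>t0\<bar> + 1"
    have "norm (cis e - 1) > 0"
    proof -
      have "sin e \<noteq> 0" using e pi_gt3 by (intro less_imp_neq[symmetric] sin_gt_zero) auto
      then show ?thesis by (auto simp: complex_eq_iff)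
    qed
    moreover have "uniformly_continuous_on (K \<times> {- T..T}) (\<lambda>(x, t). F x t)"
      using compact by (intro compact_uniformly_continuous continuous_on_subset[OF cF] compact_Times) auto
    ultimately obtain \<delta> where \<delta>: "\<delta> > 0" "\<And>v w. v \<in> K \<times> {- T..T} \<Longrightarrow> w \<in> K \<times> {- T..T} \<Longrightarrow> dist v w < \<delta> \<Longrightarrow>
      dist ((\<lambda>(x, t). F x t) v) ((\<lambda>(x, t). F x t) w) < norm (cis e - 1)"
      unfolding uniformly_continuous_on_def by meson
    obtain \<delta>' where \<delta>': "\<delta>' > 0" "\<And>t. dist t t0 < \<delta>' \<Longrightarrow> dist (L x0 t) (L x0 t0) < e' / 2"
      using L(1)[OF z'(2)] e' unfolding continuous_on_iff by (metis UNIV_I half_gt_zero)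
    show "\<exists>d>0. \<forall>w\<in>K \<times> UNIV. dist w z < d \<longrightarrow> dist (case w of (x, t) \<Rightarrow> L x t) (case z of (x, t) \<Rightarrow> L x t) < e'"
    proof (intro exI[of _ "min 1 (min \<delta> \<delta>')"] conjI ballI impI)
      fix w assume w: "w \<in> K \<times> (UNIV :: real set)" "dist w z < min 1 (min \<delta> \<delta>')"
      obtain x t where xt: "w = (x, t)" "x \<in> K" using w by auto
      have dx: "dist x x0 < \<delta>" and dt: "dist t t0 < 1" "dist t t0 < \<delta>'"
        using w dist_fst_le[of w z] dist_snd_le[of w z] unfolding xt z' by auto
      have "\<bar>L x t - L x0 t\<bar> < e"
      proof (rule small_angle[of T "\<lambda>t. L x t - L x0 t"])
        show "continuous_on {- T..T} (\<lambda>t. L x t - L x0 t)"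
          using L(1) xt(2) z'(2) by (intro continuous_intros) (auto intro: continuous_on_subset)
        show "t \<in> {- T..T}" using dt by (auto simp: T_def dist_real_def)
        fix u assume u: "u \<in> {- T..T}"
        have "cis (L x u - L x0 u) - 1 = (F x u - F x0 u) / F x0 u"
          using nF[of x0 u] L(3)[OF xt(2), of u] L(3)[OF z'(2), of u]
          by (auto simp: cis_divide[symmetric] divide_simps)
        then have "norm (cis (L x u - L x0 u) - 1) = dist (F x u) (F x0 u)"
          by (simp add: norm_divide nF dist_norm)
        also have "\<dots> < norm (cis e - 1)" using \<delta>(2)[of "(x, u)" "(x0, u)"] u xt z' dx
          by (simp add: dist_Pair_Pair)
        finally show "norm (cis (L x u - L x0 u) - 1) < norm (cis e - 1)" .
      qed (use L(2) xt z' e in auto)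
      moreover have "\<bar>L x0 t - L x0 t0\<bar> < e' / 2" using \<delta>'(2)[OF dt(2)] by (simp add: dist_real_def)
      ultimately have "\<bar>L x t - L x0 t0\<bar> < e'" using e(3) by linarith
      then show "dist (case w of (x, t) \<Rightarrow> L x t) (case z of (x, t) \<Rightarrow> L x t) < e'"
        unfolding xt z' by (simp add: dist_real_def)
    qed (use \<delta> \<delta>' in auto)
  qed
  moreover have "\<rho> (\<phi> t x) = \<rho> x * cis (L x t)" if "x \<in> K" for x t
    using L(3)[OF that, of t] nz[of x] by (simp add: F_def divide_simps)
  ultimately show ?thesis using L(2) by blast
qed

end

section \<open>Flows on inverse limits of wedges\<close>

lemma continuous_on_coordinate: "continuous_on S (\<lambda>x::nat \<Rightarrow> complex. x i)"
  by (rule continuous_on_subset[OF continuous_on_product_coordinates]) simp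

locale level_flow = compact_flow "inv_limit k f" \<phi>
  for k :: "nat \<Rightarrow> nat" and f :: "nat \<Rightarrow> complex \<Rightarrow> complex"
    and \<phi> :: "real \<Rightarrow> (nat \<Rightarrow> complex) \<Rightarrow> nat \<Rightarrow> complex" +
  assumes k: "1 \<le> k i"
    and positive_bond: "positive_map (k (Suc i)) (k i) (f i)"
    and positive_orbit: "x \<in> inv_limit k f \<Longrightarrow> positive_at (k i) (\<lambda>t. \<phi> t x i) t"
begin

abbreviation K :: "(nat \<Rightarrow> complex) set" where "K \<equiv> inv_limit k f"

text \<open>The phase advance at level i along the flow, a real cocycle. The choice operator merely
  fixes a function supplied by \<open>cocycle_exists\<close>.\<close>

definition angle :: "nat \<Rightarrow> (nat \<Rightarrow> complex) \<Rightarrow> real \<Rightarrow> real" where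
  "angle i = (SOME L. continuous_on (K \<times> UNIV) (\<lambda>(x, t). L x t) \<and> (\<forall>x\<in>K. L x 0 = 0) \<and>
    (\<forall>x\<in>K. \<forall>t. phase (\<phi> t x i) = phase (x i) * cis (L x t)))"

lemma in_wedge: "x \<in> K \<Longrightarrow> x i \<in> wedge (k i)"
  unfolding inv_limit_def by blast

lemma bond: "x \<in> K \<Longrightarrow> f i (x (Suc i)) = x i"
  unfolding inv_limit_def by (drule CollectD) (metis (no_types))

lemma angle:
  shows continuous_angle: "continuous_on (K \<times> UNIV) (\<lambda>(x, t). angle i x t)"
    and angle_0: "x \<in> K \<Longrightarrow> angle i x 0 = 0"
    and phase_angle: "x \<in> K \<Longrightarrow> phase (\<phi> t x i) = phase (x i) * cis (angle i x t)"
proof -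
  have "continuous_on K (\<lambda>x. phase (x i))"
    using in_wedge by (intro continuous_on_compose2[OF continuous_on_phase] continuous_on_coordinate) auto
  then have "\<exists>L. continuous_on (K \<times> UNIV) (\<lambda>(x, t). L x t) \<and> (\<forall>x\<in>K. L x 0 = 0) \<and>
    (\<forall>x\<in>K. \<forall>t. phase (\<phi> t x i) = phase (x i) * cis (L x t))"
    using cocycle_exists[of "\<lambda>x. phase (x i)"] by simp
  from someI_ex[OF this, folded angle_def]
  show "continuous_on (K \<times> UNIV) (\<lambda>(x, t). angle i x t)"
    "x \<in> K \<Longrightarrow> angle i x 0 = 0" "x \<in> K \<Longrightarrow> phase (\<phi> t x i) = phase (x i) * cis (angle i x t)"
    by blast+
qed

lemma continuous_on_angle:
  assumes "continuous_on S a" "continuous_on S b" "b ` S \<subseteq> K"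
  shows "continuous_on S (\<lambda>u. angle i (b u) (a u))"
proof -
  have "continuous_on S (\<lambda>u. (\<lambda>(x, t). angle i x t) (b u, a u))"
    using assms by (intro continuous_on_compose2[OF continuous_angle] continuous_on_Pair) auto
  then show ?thesis by simp
qed

lemma continuous_on_orbit: "x \<in> K \<Longrightarrow> continuous_on S (\<lambda>t. \<phi> t x)"
  by (intro continuous_on_flow continuous_intros) auto

lemma mono_curve_orbit:
  assumes x: "x \<in> K" and a: "phase (x i) = cis a"
  shows "mono_curve (k i) (\<lambda>t. \<phi> t x i) (\<lambda>t. a + angle i x t)"
proof (rule positive_mono_curve)
  show "continuous_on UNIV (\<lambda>t. \<phi> t x i)"
    by (rule continuous_on_compose2[OF continuous_on_coordinate[of UNIV] continuous_on_orbit[OF x]]) simp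
  show "continuous_on UNIV (\<lambda>t. a + angle i x t)"
    using x by (intro continuous_intros continuous_on_angle) auto
qed (use x positive_orbit in_wedge flow_in phase_angle in \<open>auto simp: a cis_mult\<close>)

lemma phase_cis: "\<exists>a. phase z = cis a"
proof -
  have "phase z \<noteq> 0" by (metis norm_phase norm_zero zero_neq_one)
  then have "cis (Arg (phase z)) = phase z" by (simp add: cis_Arg sgn_eq)
  then show ?thesis by metis
qed

lemma strict_mono_angle:
  assumes "x \<in> K" shows "strict_mono (angle i x)"
proof -
  obtain a where "phase (x i) = cis a" using phase_cis by blast
  from mono_curve_orbit[OF assms this] show ?thesis by (auto simp: mono_curve_def strict_mono_def)
qed

lemma angle_inj: "x \<in> K \<Longrightarrow> angle i x s = angle i x t \<Longrightarrow> s = t"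
  using strict_mono_angle strict_mono_eq by blast

text \<open>As functions of t both sides lift the same phase, and they agree at t = 0.\<close>

lemma angle_add:
  assumes x: "x \<in> K" shows "angle i x (s + t) = angle i x s + angle i (\<phi> s x) t"
proof -
  have sx: "\<phi> s x \<in> K" using flow_in x by blast
  have nz: "phase z \<noteq> 0" for z by (metis norm_phase norm_zero zero_neq_one)
  have "angle i x (s + t) - (angle i x s + angle i (\<phi> s x) t) =
      angle i x (s + 0) - (angle i x s + angle i (\<phi> s x) 0)"
  proof (rule cis_eq_imp_diff_const[of UNIV "\<lambda>t. angle i x (s + t)" "\<lambda>t. angle i x s + angle i (\<phi> s x) t"])
    show "continuous_on UNIV (\<lambda>t. angle i x (s + t))"
      "continuous_on UNIV (\<lambda>t. angle i x s + angle i (\<phi> s x) t)"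
      using x sx by (auto intro!: continuous_intros continuous_on_angle)
    fix t
    have "phase (x i) * cis (angle i x (s + t)) = phase (\<phi> t (\<phi> s x) i)"
      using phase_angle[OF x, of "s + t" i] flow_add[OF x, of t s] by (simp add: add.commute)
    also have "\<dots> = phase (x i) * cis (angle i x s + angle i (\<phi> s x) t)"
      using phase_angle[OF x, of s i] phase_angle[OF sx, of t i] by (simp add: cis_mult)
    finally show "cis (angle i x (s + t)) = cis (angle i x s + angle i (\<phi> s x) t)" using nz by simp
  qed auto
  then show ?thesis using angle_0[OF sx] by simp
qed

lemma angle_minus:
  assumes "x \<in> K" shows "angle i (\<phi> t x) (- t) = - angle i x t"
  using angle_add[OF assms, of i t "- t"] angle_0[OF assms] by simp

text \<open>By compactness the advance in unit time has a positive minimum m. By the cocycle law n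
  units of time advance by at least n m, forwards and backwards.\<close>

lemma surj_angle:
  assumes x: "x \<in> K" shows "surj (angle i x)"
proof -
  have "continuous_on K (\<lambda>x. angle i x 1)" by (intro continuous_on_angle continuous_intros) auto
  then obtain y where y: "y \<in> K" "\<And>z. z \<in> K \<Longrightarrow> angle i y 1 \<le> angle i z 1"
    using continuous_attains_inf[OF compact, of "\<lambda>x. angle i x 1"] x by blast
  define m where "m = angle i y 1"
  have m: "0 < m" using strict_mono_angle[OF y(1), of i] angle_0[OF y(1), of i]
    unfolding m_def strict_mono_def by (metis zero_less_one)
  have up: "real n * m \<le> angle i z (real n)" if "z \<in> K" for n z
    using that
  proof (induction n arbitrary: z)
    case (Suc n)
    have "angle i z (real (Suc n)) = angle i z 1 + angle i (\<phi> 1 z) (real n)"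
      using angle_add[OF Suc.prems, of i 1 "real n"] by simp
    moreover have "m \<le> angle i z 1" using y(2) Suc.prems by (simp add: m_def)
    moreover have "real n * m \<le> angle i (\<phi> 1 z) (real n)" using Suc flow_in by blast
    ultimately show ?case by (simp add: algebra_simps)
  qed (simp add: angle_0)
  have down: "angle i x (- real n) \<le> - (real n * m)" for n
  proof -
    have "angle i (\<phi> (- real n) x) (real n) = - angle i x (- real n)"
      using angle_minus[OF x, of i "- real n"] by simp
    then show ?thesis using up[OF flow_in[OF x], of n "- real n"] by simp
  qed
  have "\<exists>t. c = angle i x t" for c
  proof -
    obtain n :: nat where "\<bar>c\<bar> < real n * m" using m reals_Archimedean3 by blast
    then have bds: "angle i x (- real n) \<le> c" "c \<le> angle i x (real n)" using up[OF x, of n] down[of n] by linarith+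
    have "continuous_on UNIV (angle i x)"
      using x continuous_on_angle[of UNIV "\<lambda>t. t" "\<lambda>_. x" i] by auto
    then have "connected (range (angle i x))" by (rule connected_continuous_image) (rule connected_UNIV)
    then have "is_interval (range (angle i x))" by (simp add: is_interval_connected_1)
    then have "c \<in> range (angle i x)" using bds unfolding is_interval_1 by blast
    then show ?thesis by blast
  qed
  then show ?thesis by blast
qed

end

section \<open>Countable fibres\<close>

lemma countable_cis_fibre: "countable {a. cis a = w}"
proof (cases "{a. cis a = w} = {}")
  case False
  then obtain a where "cis a = w" by blast
  then have "{a. cis a = w} \<subseteq> range (\<lambda>n::int. a + 2 * pi * of_int n)" by (auto simp: cis_eq_iff)
  then show ?thesis by (rule countable_subset) simp
qed simp

lemma countable_wedge_phase_fibre: "countable {z \<in> wedge k. phase z = w}"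
proof (rule countable_subset)
  show "{z \<in> wedge k. phase z = w} \<subseteq> (\<Union>j\<in>{1..k}. circ j ` {a. cis a = w})"
    using phase_circ by (force simp: wedge_iff)
qed (intro countable_UN countable_image countable_cis_fibre, simp)

text \<open>Along each circle f has an injective phase lift, and countably many phases have only
  countably many lifted values.\<close>

lemma countable_positive_preimage:
  assumes f: "positive_map k' k f" and C: "countable C"
  shows "countable {z \<in> wedge k'. f z \<in> C}"
proof (rule countable_subset)
  show "{z \<in> wedge k'. f z \<in> C} \<subseteq> (\<Union>j\<in>{1..k'}. circ j ` {s. f (circ j s) \<in> C})"
    by (force simp: wedge_iff)
  have "countable {s. f (circ j s) \<in> C}" if j: "j \<in> {1..k'}" for j
  proof -
    obtain \<Theta> where \<Theta>: "mono_curve k (\<lambda>s. f (circ j s)) \<Theta>" using positive_map_circ_curve[OF f j] .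
    have ph: "cis (\<Theta> s) = phase (f (circ j s))" for s using \<Theta> by (simp add: mono_curve_def)
    have "\<Theta> ` {s. f (circ j s) \<in> C} \<subseteq> (\<Union>z\<in>C. {a. cis a = phase z})"
      by (auto simp: ph)
    moreover have "countable (\<Union>z\<in>C. {a. cis a = phase z})"
      using C by (intro countable_UN countable_cis_fibre)
    ultimately have "countable (\<Theta> ` {s. f (circ j s) \<in> C})" by (rule countable_subset)
    moreover have "inj_on \<Theta> {s. f (circ j s) \<in> C}"
      using \<Theta> by (auto simp: mono_curve_def intro: inj_on_subset[OF strict_mono_imp_inj_on])
    ultimately show ?thesis by (rule countable_image_inj_on)
  qed
  then show "countable (\<Union>j\<in>{1..k'}. circ j ` {s. f (circ j s) \<in> C})"
    by (intro countable_UN countable_image) auto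
qed

lemma continuous_countable_range_constant:
  fixes c :: "real \<Rightarrow> 'a::metric_space"
  assumes "continuous_on UNIV c" "countable (range c)"
  shows "c s = c t"
proof (rule ccontr)
  assume "c s \<noteq> c t"
  moreover have "connected (range c)" using assms(1) connected_UNIV by (rule connected_continuous_image)
  ultimately have "uncountable (range c)" by (intro connected_uncountable[of _ "c s" "c t"]) auto
  then show False using assms(2) by simp
qed

lemma compact_wedge: "compact (wedge k)"
proof -
  have "wedge k = (\<Union>j\<in>{1..k}. circ j ` {0..2 * pi})"
    using wedge_param circ_in_wedge by (auto; blast)
  then show ?thesis
    by (auto intro!: compact_UN compact_continuous_image continuous_on_circ)
qed

context level_flow
begin

lemma continuous_on_level:
  assumes "continuous_on S a" "continuous_on S b" "b ` S \<subseteq> K"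
  shows "continuous_on S (\<lambda>u. \<phi> (a u) (b u) i)"
  using continuous_on_compose2[OF continuous_on_coordinate[of UNIV i] continuous_on_flow[OF assms]] by simp

text \<open>M lifts the phase of the g-image of the orbit, relative to the phase of
  \<open>z i\<close>; it is onto because \<Delta> is bounded on the compact wedge. Solving M = -2 pi
  d matches the g-image at time \<open>\<tau> z\<close> with the f-image at time 0, which is
  \<open>z i\<close>. Constancy of angle plus \<Delta> is recorded because it lets the displacement
  be recovered from the displaced point.\<close>

lemma level_shift:
  assumes g: "positive_map (k (Suc i)) (k i) g"
    and conj: "pi1_conj_by (wedge (k i)) 0 (wedge (k (Suc i))) 0 \<alpha> g (f i)"
  shows "\<exists>\<Delta> c \<tau>. continuous_on K \<tau> \<and>
    (\<forall>z\<in>K. angle i z (\<tau> z) + \<Delta> (\<phi> (\<tau> z) z (Suc i)) = c \<and> g (\<phi> (\<tau> z) z (Suc i)) = z i)"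
proof -
  obtain \<Delta> where \<Delta>: "continuous_on (wedge (k (Suc i))) \<Delta>" "\<Delta> 0 = 0"
    "\<And>z. z \<in> wedge (k (Suc i)) \<Longrightarrow> phase (g z) = phase (f i z) * cis (\<Delta> z)"
    using conjugate_phase_difference[OF positive_bond[of i] g k[of i] k[of "Suc i"] conj] by blast
  obtain d :: int where d: "\<forall>\<gamma> \<eta> \<theta> s t. mono_curve (k (Suc i)) \<gamma> \<eta> \<longrightarrow> surj \<eta> \<longrightarrow> continuous_on UNIV \<theta> \<longrightarrow>
    (\<forall>t. phase (f i (\<gamma> t)) = cis (\<theta> t)) \<longrightarrow> \<theta> s + \<Delta> (\<gamma> s) = \<theta> t - 2 * pi * of_int d \<longrightarrow> g (\<gamma> s) = f i (\<gamma> t)"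
    using conjugate_curves_agree[OF positive_bond[of i] g k[of i] k[of "Suc i"] conj \<Delta>] by blast
  obtain B where B: "\<And>z. z \<in> wedge (k (Suc i)) \<Longrightarrow> \<bar>\<Delta> z\<bar> \<le> B"
    using compact_imp_bounded[OF compact_continuous_image[OF \<Delta>(1) compact_wedge]]
    by (auto simp: bounded_iff)
  have inw: "\<phi> t z (Suc i) \<in> wedge (k (Suc i))" if "z \<in> K" for t z using that flow_in in_wedge by blast
  define M where "M z t = angle i z t + \<Delta> (\<phi> t z (Suc i))" for z t
  have cM: "continuous_on S (\<lambda>u. M (b u) (a u))" if "continuous_on S a" "continuous_on S b" "b ` S \<subseteq> K"
    for S :: "'z::topological_space set" and a b
    unfolding M_def using that inw
    by (intro continuous_on_add continuous_on_angle continuous_on_compose2[OF \<Delta>(1) continuous_on_level]) auto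
  have sm: "strict_mono (M z)" if z: "z \<in> K" for z
  proof -
    obtain a where a: "phase (z (Suc i)) = cis a" using phase_cis by blast
    obtain b where b: "phase (z i) = cis b" using phase_cis by blast
    have "mono_curve (k i) (\<lambda>t. g (\<phi> t z (Suc i))) (\<lambda>t. b + M z t)"
    proof (rule positive_map_mono_curve[OF g k mono_curve_orbit[OF z a]])
      show "continuous_on UNIV (\<lambda>t. b + M z t)"
        using z cM[of UNIV "\<lambda>t. t" "\<lambda>_. z"] by (intro continuous_intros) auto
      show "phase (g (\<phi> t z (Suc i))) = cis (b + M z t)" for t
        using \<Delta>(3)[OF inw[OF z]] bond[OF flow_in[OF z], of i t] phase_angle[OF z, of t i]
        by (simp add: M_def b cis_mult add.assoc)
    qed
    then show ?thesis by (simp add: mono_curve_def strict_mono_def)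
  qed
  have su: "surj (M z)" if z: "z \<in> K" for z
    using cM[of UNIV "\<lambda>t. t" "\<lambda>_. z"] z surj_angle[OF z, of i] B inw[OF z]
    by (intro surj_bounded_perturbation[of "M z" "angle i z" B]) (auto simp: M_def)
  have "continuous_on (K \<times> UNIV) (\<lambda>(z, t). M z t)"
    unfolding case_prod_unfold
    by (rule cM[OF continuous_on_snd[OF continuous_on_id] continuous_on_fst[OF continuous_on_id]]) auto
  from implicit_solution[OF this sm su, of "- 2 * pi * of_int d"]
  obtain \<tau> where \<tau>: "continuous_on K \<tau>" "\<And>z. z \<in> K \<Longrightarrow> M z (\<tau> z) = - 2 * pi * of_int d" by blast
  have "g (\<phi> (\<tau> z) z (Suc i)) = z i" if z: "z \<in> K" for z
  proof -
    obtain a where a: "phase (z (Suc i)) = cis a" using phase_cis by blast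
    obtain b where b: "phase (z i) = cis b" using phase_cis by blast
    have "g (\<phi> (\<tau> z) z (Suc i)) = f i (\<phi> 0 z (Suc i))"
    proof (rule d[rule_format, OF mono_curve_orbit[OF z a], where \<theta> = "\<lambda>t. b + angle i z t"])
      show "surj (\<lambda>t. a + angle (Suc i) z t)"
      proof (rule surjI)
        show "a + angle (Suc i) z (inv (angle (Suc i) z) (y - a)) = y" for y
          using surj_f_inv_f[OF surj_angle[OF z, of "Suc i"], of "y - a"] by simp
      qed
      show "continuous_on UNIV (\<lambda>t. b + angle i z t)"
        using z by (intro continuous_intros continuous_on_angle) auto
      show "phase (f i (\<phi> t z (Suc i))) = cis (b + angle i z t)" for t
        using bond[OF flow_in[OF z], of i t] phase_angle[OF z, of t i] by (simp add: b cis_mult)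
      show "b + angle i z (\<tau> z) + \<Delta> (\<phi> (\<tau> z) z (Suc i)) = b + angle i z 0 - 2 * pi * of_int d"
        using \<tau>(2)[OF z] angle_0[OF z, of i] by (simp add: M_def)
    qed
    then show ?thesis using flow_0[OF z] bond[OF z] by simp
  qed
  then show ?thesis using \<tau> unfolding M_def by blast
qed

text \<open>Whole itineraries are compared, since \<open>x i = y i\<close> alone does not tell how
  the two points move at level i. The time changes are not asked to be monotone: those produced by
  delays come only with continuity and a bound. Surjectivity of \<open>a\<close> allows any
  displacement of the first point to be undone.\<close>

definition same_level :: "nat \<Rightarrow> (nat \<Rightarrow> complex) \<Rightarrow> (nat \<Rightarrow> complex) \<Rightarrow> bool" where
  "same_level i x y \<longleftrightarrow> (\<exists>(a :: real \<Rightarrow> real) (b :: real \<Rightarrow> real). continuous_on UNIV a \<and> continuous_on UNIV b \<and> a 0 = 0 \<and> b 0 = 0 \<and> surj a \<and>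
     (\<forall>t. \<phi> (a t) x i = \<phi> (b t) y i))"

lemma level_eq_mono:
  assumes "x \<in> K" "y \<in> K" "x i = y i" "j \<le> i"
  shows "x j = y j"
  using assms(4,3)
proof (induction rule: inc_induct)
  case (step n)
  then show ?case using bond[OF assms(1), of n] bond[OF assms(2), of n] by simp
qed

lemma same_level_imp_eq:
  assumes "x \<in> K" "y \<in> K" "same_level i x y"
  shows "x i = y i"
  using assms flow_0 unfolding same_level_def by metis

text \<open>The displacement that inverts a level shift is read off from the level itinerary of the image.\<close>

lemma same_level_shift:
  assumes x: "x \<in> K" "x' \<in> K" and ji: "j < i"
    and \<tau>: "angle j x \<tau> + \<Delta> (\<phi> \<tau> x (Suc j)) = c" "angle j x' \<tau>' + \<Delta> (\<phi> \<tau>' x' (Suc j)) = c"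
    and same: "same_level i (\<phi> \<tau> x) (\<phi> \<tau>' x')"
  shows "same_level i x x'"
proof -
  let ?w = "\<phi> \<tau> x" and ?w' = "\<phi> \<tau>' x'"
  have w: "?w \<in> K" "?w' \<in> K" using x flow_in by auto
  obtain a b :: "real \<Rightarrow> real" where ab: "continuous_on UNIV a" "continuous_on UNIV b" "a 0 = 0" "b 0 = 0" "surj a"
    "\<And>t. \<phi> (a t) ?w i = \<phi> (b t) ?w' i" using same unfolding same_level_def by blast
  have "?w i = ?w' i" using same_level_imp_eq[OF w same] .
  then have eq: "?w (Suc j) = ?w' (Suc j)" "?w j = ?w' j"
    using level_eq_mono[OF w, of i] ji by auto
  \<comment> \<open>Level i determines level j, so the matched itineraries have equal phases there;
    both angles start at 0 and hence stay equal.\<close>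
  have ang: "angle j ?w (a t) = angle j ?w' (b t)" for t
  proof -
    have "angle j ?w (a t) - angle j ?w' (b t) = angle j ?w (a 0) - angle j ?w' (b 0)"
    proof (rule cis_eq_imp_diff_const[of UNIV "\<lambda>t. angle j ?w (a t)" "\<lambda>t. angle j ?w' (b t)"])
      fix t
      have "\<phi> (a t) ?w j = \<phi> (b t) ?w' j"
        using level_eq_mono[OF flow_in[OF w(1)] flow_in[OF w(2)] ab(6)] ji by simp
      then have "phase (?w j) * cis (angle j ?w (a t)) = phase (?w j) * cis (angle j ?w' (b t))"
        using phase_angle[OF w(1), of "a t" j] phase_angle[OF w(2), of "b t" j] eq(2) by metis
      moreover have "phase (?w j) \<noteq> 0" by (metis norm_phase norm_zero zero_neq_one)
      ultimately show "cis (angle j ?w (a t)) = cis (angle j ?w' (b t))"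
        using mult_cancel_left by blast
    qed (use ab w in \<open>auto intro!: continuous_on_angle\<close>)
    then show ?thesis using ab angle_0 w by simp
  qed
  \<comment> \<open>The time at which the first itinerary has undone its displacement. Equality of
    angles will force the second one to have undone its own.\<close>
  obtain t1 where t1: "a t1 = - \<tau>" using ab(5) by (metis surjD)
  have "angle j ?w' (b t1) = angle j ?w (- \<tau>)" using ang[of t1] t1 by simp
  \<comment> \<open>Either angle is \<Delta> at level \<open>Suc j\<close> of the displaced point
    minus c, and the displaced points agree at that level because \<open>j < i\<close>.\<close>
  also have "\<dots> = angle j ?w' (- \<tau>')"
    using angle_minus[OF x(1), of j \<tau>] angle_minus[OF x(2), of j \<tau>'] \<tau> eq by simp
  finally have "b t1 = - \<tau>'" using angle_inj[OF w(2)] by blast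
  then have "\<phi> (a (t + t1) + \<tau>) x i = \<phi> (b (t + t1) + \<tau>') x' i" for t
    using ab(6)[of "t + t1"] flow_add x by simp
  moreover have "surj (\<lambda>t. a (t + t1) + \<tau>)"
  proof (rule surjI)
    show "a (inv a (y - \<tau>) - t1 + t1) + \<tau> = y" for y using surj_f_inv_f[OF ab(5), of "y - \<tau>"] by simp
  qed
  moreover have "continuous_on UNIV (\<lambda>t. a (t + t1) + \<tau>)" "continuous_on UNIV (\<lambda>t. b (t + t1) + \<tau>')"
    using ab by (auto intro!: continuous_intros intro: continuous_on_compose2)
  ultimately show ?thesis unfolding same_level_def using t1 \<open>b t1 = - \<tau>'\<close>
    by (intro exI[of _ "\<lambda>t. a (t + t1) + \<tau>"] exI[of _ "\<lambda>t. b (t + t1) + \<tau>'"]) auto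
qed

end

section \<open>The conjugating map\<close>

locale shifted_flows = X: level_flow k f \<phi> + Y: level_flow k g \<psi>
  for k f g \<phi> \<psi> +
  fixes \<Delta> :: "nat \<Rightarrow> complex \<Rightarrow> real" and c :: "nat \<Rightarrow> real" and \<tau> :: "nat \<Rightarrow> (nat \<Rightarrow> complex) \<Rightarrow> real"
  assumes continuous_shift: "continuous_on X.K (\<tau> i)"
    and angle_shift: "z \<in> X.K \<Longrightarrow> X.angle i z (\<tau> i z) + \<Delta> i (\<phi> (\<tau> i z) z (Suc i)) = c i"
    and bond_shift: "z \<in> X.K \<Longrightarrow> g i (\<phi> (\<tau> i z) z (Suc i)) = z i"
begin

text \<open>Each level shift is evaluated at the point already displaced by the earlier ones.
  \<open>bond_shift\<close> at that point is then exactly the compatibility of coordinates i and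
  \<open>Suc i\<close> of \<open>conj_map\<close>.\<close>

primrec delay :: "nat \<Rightarrow> (nat \<Rightarrow> complex) \<Rightarrow> real" where
  "delay 0 x = 0"
| "delay (Suc i) x = \<tau> i (\<phi> (delay i x) x) + delay i x"

definition conj_map :: "(nat \<Rightarrow> complex) \<Rightarrow> nat \<Rightarrow> complex" where
  "conj_map x = (\<lambda>i. \<phi> (delay i x) x i)"

lemma flow_delay_Suc:
  "x \<in> X.K \<Longrightarrow> \<phi> (delay (Suc i) x) x = \<phi> (\<tau> i (\<phi> (delay i x) x)) (\<phi> (delay i x) x)"
  by (simp add: X.flow_add)

lemma continuous_delay: "continuous_on X.K (delay i)"
proof (induction i)
  case (Suc i)
  then have "continuous_on X.K (\<lambda>x. \<tau> i (\<phi> (delay i x) x))"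
    by (intro continuous_on_compose2[OF continuous_shift X.continuous_on_flow])
      (auto simp: X.flow_in intro: continuous_on_id)
  then show ?case using Suc by (simp add: continuous_on_add)
qed (simp add: continuous_on_const)

lemma conj_map_in: "x \<in> X.K \<Longrightarrow> conj_map x \<in> Y.K"
proof -
  assume x: "x \<in> X.K"
  have "conj_map x i = g i (conj_map x (Suc i))" for i
    using bond_shift[OF X.flow_in[OF x], of i "delay i x"] flow_delay_Suc[OF x, of i]
    by (simp add: conj_map_def)
  moreover have "conj_map x i \<in> wedge (k i)" for i
    using X.in_wedge X.flow_in[OF x] by (simp add: conj_map_def)
  ultimately show ?thesis unfolding inv_limit_def by blast
qed

lemma continuous_conj_map: "continuous_on X.K conj_map"
proof (rule continuous_on_coordinatewise_then_product)
  fix i show "continuous_on X.K (\<lambda>x. conj_map x i)"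
    unfolding conj_map_def
    by (intro X.continuous_on_level continuous_delay continuous_on_id) auto
qed

lemma conj_map_0: "x \<in> X.K \<Longrightarrow> conj_map x 0 = x 0"
  by (simp add: conj_map_def X.flow_0)

text \<open>Moving the points of a path back along the flow to a fixed phase at level 0 leaves a path all
  of whose levels have countable range; hence the path stays in one orbit.\<close>

lemma conj_map_orbit:
  assumes x: "x \<in> X.K"
  obtains \<sigma> where "continuous_on UNIV \<sigma>" "strict_mono \<sigma>" "surj \<sigma>" "\<sigma> 0 = 0"
    "\<And>t. conj_map (\<phi> t x) = \<psi> (\<sigma> t) (conj_map x)"
    "\<And>t. Y.angle 0 (conj_map x) (\<sigma> t) = X.angle 0 x t"
proof -
  define e where "e t = conj_map (\<phi> t x)" for t
  have eK: "e t \<in> Y.K" for t unfolding e_def using conj_map_in X.flow_in[OF x] by blast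
  have ce: "continuous_on UNIV e" unfolding e_def
    by (intro continuous_on_compose2[OF continuous_conj_map X.continuous_on_orbit[OF x]])
      (use X.flow_in[OF x] in auto)
  have e0: "e 0 = conj_map x" by (simp add: e_def X.flow_0[OF x])
  \<comment> \<open>The root of \<open>M t\<close> is the time that takes \<open>e t\<close> back to
    the level-0 phase of x.\<close>
  define M where "M t r = Y.angle 0 (e t) r + X.angle 0 x t" for t r
  have "continuous_on (UNIV \<times> UNIV) (\<lambda>(t, r). M t r)"
    unfolding M_def case_prod_unfold
    by (intro continuous_on_add Y.continuous_on_angle X.continuous_on_angle continuous_on_compose2[OF ce]
        continuous_intros) (use eK x in auto)
  moreover have "strict_mono (M t)" for t
    using Y.strict_mono_angle[OF eK, of 0 t] by (simp add: M_def strict_mono_def)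
  moreover have "surj (M t)" for t
  proof (rule surjI)
    show "M t (inv (Y.angle 0 (e t)) (y - X.angle 0 x t)) = y" for y
      using surj_f_inv_f[OF Y.surj_angle[OF eK, of 0 t], of "y - X.angle 0 x t"] by (simp add: M_def)
  qed
  ultimately obtain r where r: "continuous_on UNIV r" "\<And>t. M t (r t) = 0"
    using implicit_solution[of UNIV M 0] by auto
  have r0: "r 0 = 0"
    using r(2)[of 0] Y.angle_0[OF eK, of 0 0] X.angle_0[OF x, of 0] Y.angle_inj[OF eK, of 0 0 "r 0" 0]
    by (simp add: M_def)
  define w where "w t = \<psi> (r t) (e t)" for t
  have wK: "w t \<in> Y.K" for t unfolding w_def using Y.flow_in eK by blast
  have "\<exists>C. countable C \<and> (\<forall>t. w t i \<in> C)" for i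
  proof (induction i)
    case 0
    have "phase (w t 0) = phase (x 0)" for t
    proof -
      \<comment> \<open>Level 0 has no delay, so \<open>e t\<close> and \<open>\<phi> t x\<close>
        share this coordinate.\<close>
      have "phase (e t 0) = phase (x 0) * cis (X.angle 0 x t)"
        using X.phase_angle[OF x, of t 0] conj_map_0[OF X.flow_in[OF x], of t] by (simp add: e_def)
      moreover have "Y.angle 0 (e t) (r t) = - X.angle 0 x t" using r(2)[of t] by (simp add: M_def)
      ultimately show ?thesis using Y.phase_angle[OF eK, of "r t" t 0]
        by (simp add: w_def cis_mult mult.assoc)
    qed
    then show ?case using Y.in_wedge[OF wK] countable_wedge_phase_fibre[of "k 0" "phase (x 0)"] by blast
  next
    case (Suc i)
    then obtain C where C: "countable C" "\<And>t. w t i \<in> C" by blast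
    have "w t (Suc i) \<in> {z \<in> wedge (k (Suc i)). g i z \<in> C}" for t
      using Y.in_wedge[OF wK] Y.bond[OF wK, of i t] C(2)[of t] by simp
    then show ?case using countable_positive_preimage[OF Y.positive_bond C(1)] by blast
  qed
  moreover have "continuous_on UNIV (\<lambda>t. w t i)" for i
    unfolding w_def by (intro Y.continuous_on_level r(1) ce) (use eK in auto)
  ultimately have "w t i = w 0 i" for t i
  proof -
    assume *: "\<And>i. \<exists>C. countable C \<and> (\<forall>t. w t i \<in> C)" "\<And>i. continuous_on UNIV (\<lambda>t. w t i)"
    obtain C where C: "countable C" "\<And>t. w t i \<in> C" using *(1) by blast
    then have "countable (range (\<lambda>t. w t i))" by (intro countable_subset[OF _ C(1)]) auto
    with *(2) show ?thesis by (rule continuous_countable_range_constant)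
  qed
  then have "w t = w 0" for t by blast
  then have w: "\<psi> (r t) (e t) = conj_map x" for t
    using Y.flow_0 eK[of 0] unfolding w_def r0 e0 by simp
  define \<sigma> where "\<sigma> t = - r t" for t
  have orb: "e t = \<psi> (\<sigma> t) (conj_map x)" for t
    using Y.flow_add[OF eK, of "- r t" "r t" t] Y.flow_0[OF eK] w[of t] by (simp add: \<sigma>_def)
  have ang: "Y.angle 0 (conj_map x) (\<sigma> t) = X.angle 0 x t" for t
    using Y.angle_minus[OF eK, of 0 "r t" t] w[of t] r(2)[of t] by (simp add: \<sigma>_def M_def)
  have y: "conj_map x \<in> Y.K" using conj_map_in[OF x] .
  show ?thesis
  proof (rule that[of \<sigma>])
    show "continuous_on UNIV \<sigma>" unfolding \<sigma>_def using r(1) by (intro continuous_intros)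
    \<comment> \<open>Both level-0 angles are increasing bijections of the line, and \<sigma>
      intertwines them.\<close>
    show "strict_mono \<sigma>"
    proof (rule strict_monoI)
      fix s t :: real assume "s < t"
      then have "Y.angle 0 (conj_map x) (\<sigma> s) < Y.angle 0 (conj_map x) (\<sigma> t)"
        using X.strict_mono_angle[OF x, of 0] unfolding ang by (simp add: strict_mono_def)
      then show "\<sigma> s < \<sigma> t" using Y.strict_mono_angle[OF y, of 0] by (simp add: strict_mono_less)
    qed
    have "\<exists>t. u = \<sigma> t" for u
    proof -
      obtain t where "Y.angle 0 (conj_map x) u = X.angle 0 x t" using X.surj_angle[OF x, of 0] by (metis surjD)
      then show ?thesis using Y.angle_inj[OF y, of 0 u "\<sigma> t"] ang by auto
    qed
    then show "surj \<sigma>" by blast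
    show "conj_map (\<phi> t x) = \<psi> (\<sigma> t) (conj_map x)" for t using orb by (simp add: e_def)
  qed (use r0 ang in \<open>auto simp: \<sigma>_def\<close>)
qed

text \<open>Level-0 angles match time t on the orbit of x with time \<open>\<rho> t\<close> on that
  of x', with equal images throughout. So the points displaced i times have the same level-i
  itinerary, and undoing the displacements one by one gives \<open>x i = x' i\<close>.\<close>

lemma conj_map_inj: "inj_on conj_map X.K"
proof (rule inj_onI)
  fix x x' assume x: "x \<in> X.K" "x' \<in> X.K" and eq: "conj_map x = conj_map x'"
  obtain \<sigma> where \<sigma>: "\<And>t. conj_map (\<phi> t x) = \<psi> (\<sigma> t) (conj_map x)"
    "\<And>t. Y.angle 0 (conj_map x) (\<sigma> t) = X.angle 0 x t" using conj_map_orbit[OF x(1)] by metis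
  obtain \<sigma>' where \<sigma>': "\<And>t. conj_map (\<phi> t x') = \<psi> (\<sigma>' t) (conj_map x')"
    "\<And>t. Y.angle 0 (conj_map x') (\<sigma>' t) = X.angle 0 x' t" using conj_map_orbit[OF x(2)] by metis
  define M where "M t u = X.angle 0 x' u - X.angle 0 x t" for t u
  have "continuous_on (UNIV \<times> UNIV) (\<lambda>(t, u). M t u)"
    unfolding M_def case_prod_unfold
    by (intro continuous_on_diff X.continuous_on_angle continuous_intros) (use x in auto)
  moreover have "strict_mono (M t)" for t
    using X.strict_mono_angle[OF x(2), of 0] by (simp add: M_def strict_mono_def)
  moreover have "surj (M t)" for t
  proof (rule surjI)
    show "M t (inv (X.angle 0 x') (y + X.angle 0 x t)) = y" for y
      using surj_f_inv_f[OF X.surj_angle[OF x(2), of 0], of "y + X.angle 0 x t"] by (simp add: M_def)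
  qed
  ultimately obtain \<rho> where \<rho>: "continuous_on UNIV \<rho>" "\<And>t. M t (\<rho> t) = 0"
    using implicit_solution[of UNIV M 0] by auto
  have \<rho>0: "\<rho> 0 = 0"
    using \<rho>(2)[of 0] X.angle_0[OF x(1), of 0] X.angle_0[OF x(2), of 0] X.angle_inj[OF x(2), of 0 "\<rho> 0" 0]
    by (simp add: M_def)
  have same: "conj_map (\<phi> t x) = conj_map (\<phi> (\<rho> t) x')" for t
  proof -
    have "Y.angle 0 (conj_map x) (\<sigma> t) = Y.angle 0 (conj_map x) (\<sigma>' (\<rho> t))"
      using \<sigma>(2)[of t] \<sigma>'(2)[of "\<rho> t"] \<rho>(2)[of t] eq by (simp add: M_def)
    then have "\<sigma> t = \<sigma>' (\<rho> t)" using Y.angle_inj[OF conj_map_in[OF x(1)]] by blast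
    then show ?thesis using \<sigma>(1)[of t] \<sigma>'(1)[of "\<rho> t"] eq by simp
  qed
  have "x i = x' i" for i
  proof -
    let ?S = "\<lambda>j x. \<phi> (delay j x) x"
    have SK: "?S j x \<in> X.K" "?S j x' \<in> X.K" for j using X.flow_in x by auto
    \<comment> \<open>Elapsed times between the displaced starting points and the displaced points
      of the two orbits.\<close>
    define a where "a t = t + delay i (\<phi> t x) - delay i x" for t
    define b where "b t = \<rho> t + delay i (\<phi> (\<rho> t) x') - delay i x'" for t
    have ca: "continuous_on UNIV a" unfolding a_def
      by (intro continuous_intros continuous_on_compose2[OF continuous_delay X.continuous_on_orbit[OF x(1)]])
        (use X.flow_in x in auto)
    have cb: "continuous_on UNIV b" unfolding b_def
      by (intro continuous_intros \<rho>(1) continuous_on_compose2[OF continuous_delay]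
          X.continuous_on_flow) (use X.flow_in x \<rho> in auto)
    \<comment> \<open>For fixed i the delay is bounded by compactness, so \<open>a\<close> is a
      bounded perturbation of the identity and therefore onto.\<close>
    have "bounded (delay i ` X.K)"
      using compact_continuous_image[OF continuous_delay X.compact] by (rule compact_imp_bounded)
    then obtain B where B: "\<And>z. z \<in> X.K \<Longrightarrow> \<bar>delay i z\<bar> \<le> B" by (auto simp: bounded_iff)
    have "\<bar>a t - t\<bar> \<le> B + B" for t
      using B[OF X.flow_in[OF x(1)], of t] B[OF x(1)] unfolding a_def by linarith
    then have sa: "surj a" using surj_bounded_perturbation[OF ca surj_id[unfolded id_def]] by blast
    have "\<phi> (a t) (?S i x) i = \<phi> (b t) (?S i x') i" for t
    proof -
      have "\<phi> (a t) (?S i x) = \<phi> (delay i (\<phi> t x)) (\<phi> t x)"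
        using X.flow_add[OF x(1), of "a t" "delay i x"] X.flow_add[OF x(1), of "delay i (\<phi> t x)" t]
        by (simp add: a_def add.commute)
      moreover have "\<phi> (b t) (?S i x') = \<phi> (delay i (\<phi> (\<rho> t) x')) (\<phi> (\<rho> t) x')"
        using X.flow_add[OF x(2), of "b t" "delay i x'"] X.flow_add[OF x(2), of "delay i (\<phi> (\<rho> t) x')" "\<rho> t"]
        by (simp add: b_def add.commute)
      ultimately show ?thesis using same[of t] unfolding conj_map_def by metis
    qed
    moreover have "a 0 = 0" "b 0 = 0" using x by (simp_all add: a_def b_def \<rho>0 X.flow_0)
    ultimately have top: "X.same_level i (?S i x) (?S i x')"
      unfolding X.same_level_def using ca cb sa by blast
    have "X.same_level i (?S j x) (?S j x')" if "j \<le> i" for j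
      using that
    proof (induction rule: inc_induct)
      case (step j)
      then have "X.same_level i (\<phi> (\<tau> j (?S j x)) (?S j x)) (\<phi> (\<tau> j (?S j x')) (?S j x'))"
        using flow_delay_Suc x by metis
      then show ?case
        using X.same_level_shift[OF SK step.hyps(2) angle_shift[OF SK(1)] angle_shift[OF SK(2)]] by blast
    qed (rule top)
    from this[of 0] have "X.same_level i x x'" using X.flow_0 x by simp
    then show ?thesis using X.same_level_imp_eq x by blast
  qed
  then show "x = x'" by blast
qed

text \<open>The image is closed by compactness, and it contains a whole orbit of \<psi> because the
  time change is onto; that orbit is dense.\<close>

lemma conj_map_surj:
  assumes ne: "X.K \<noteq> {}" and dense: "\<And>y. y \<in> Y.K \<Longrightarrow> Y.K \<subseteq> closure (range (\<lambda>t. \<psi> t y))"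
  shows "conj_map ` X.K = Y.K"
proof
  obtain x where x: "x \<in> X.K" using ne by blast
  obtain \<sigma> where \<sigma>: "surj \<sigma>" "\<And>t. conj_map (\<phi> t x) = \<psi> (\<sigma> t) (conj_map x)"
    using conj_map_orbit[OF x] by metis
  have "range (\<lambda>t. \<psi> t (conj_map x)) \<subseteq> conj_map ` X.K"
  proof safe
    fix u obtain t where "u = \<sigma> t" using \<sigma>(1) by blast
    then show "\<psi> u (conj_map x) \<in> conj_map ` X.K" using \<sigma>(2)[of t] X.flow_in[OF x] by (metis imageI)
  qed
  moreover have "closed (conj_map ` X.K)"
    using compact_continuous_image[OF continuous_conj_map X.compact] by (rule compact_imp_closed)
  ultimately have "closure (range (\<lambda>t. \<psi> t (conj_map x))) \<subseteq> conj_map ` X.K" by (rule closure_minimal)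
  then show "Y.K \<subseteq> conj_map ` X.K" using dense[OF conj_map_in[OF x]] by blast
qed (use conj_map_in in blast)

end

lemma conjugate_level_flows_equivalent:
  assumes X: "level_flow k f \<phi>" and Y: "level_flow k g \<psi>"
    and conj: "\<And>i. \<exists>\<alpha>. pi1_conj_by (wedge (k i)) 0 (wedge (k (Suc i))) 0 \<alpha> (g i) (f i)"
    and ne: "inv_limit k f \<noteq> {}"
    and dense: "\<And>y. y \<in> inv_limit k g \<Longrightarrow> inv_limit k g \<subseteq> closure (range (\<lambda>t. \<psi> t y))"
  shows "\<exists>h. homeomorphic_map (top_of_set (inv_limit k f)) (top_of_set (inv_limit k g)) h \<and>
    (\<forall>x\<in>inv_limit k f. \<exists>\<sigma>. continuous_on UNIV \<sigma> \<and> strict_mono \<sigma> \<and> surj \<sigma> \<and>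
      (\<forall>t. h (\<phi> t x) = \<psi> (\<sigma> t) (h x)))"
proof -
  interpret X: level_flow k f \<phi> by fact
  interpret Y: level_flow k g \<psi> by fact
  have "\<exists>\<Delta> c \<tau>. continuous_on X.K \<tau> \<and>
    (\<forall>z\<in>X.K. X.angle i z (\<tau> z) + \<Delta> (\<phi> (\<tau> z) z (Suc i)) = c \<and> g i (\<phi> (\<tau> z) z (Suc i)) = z i)" for i
    using X.level_shift[OF Y.positive_bond] conj[of i] by blast
  then obtain \<Delta> c \<tau> where "\<And>i. continuous_on X.K (\<tau> i) \<and>
    (\<forall>z\<in>X.K. X.angle i z (\<tau> i z) + \<Delta> i (\<phi> (\<tau> i z) z (Suc i)) = c i \<and> g i (\<phi> (\<tau> i z) z (Suc i)) = z i)"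
    by metis
  then interpret shifted_flows k f g \<phi> \<psi> \<Delta> c \<tau>
    by unfold_locales blast+
  have "homeomorphic_map (top_of_set X.K) (top_of_set Y.K) conj_map"
  proof (rule continuous_imp_homeomorphic_map)
    show "compact_space (top_of_set X.K)" using X.compact by (simp add: compact_space_subtopology)
    show "Hausdorff_space (top_of_set Y.K)" by (simp add: Hausdorff_space_subtopology)
    show "continuous_map (top_of_set X.K) (top_of_set Y.K) conj_map"
      using continuous_conj_map conj_map_in by (auto simp: continuous_map_in_subtopology)
  qed (use conj_map_surj[OF ne dense] conj_map_inj in auto)
  moreover have "\<exists>\<sigma>. continuous_on UNIV \<sigma> \<and> strict_mono \<sigma> \<and> surj \<sigma> \<and>
      (\<forall>t. conj_map (\<phi> t x) = \<psi> (\<sigma> t) (conj_map x))" if "x \<in> X.K" for x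
    using conj_map_orbit[OF that] by metis
  ultimately show ?thesis by blast
qed

section \<open>Transfer to abstract flow spaces\<close>

text \<open>The Euclidean topology of the type \<open>nat \<Rightarrow> complex\<close> is the
  product topology, so the inverse limit can be handled as a subset of a metric space.\<close>

lemma inv_limit_topology:
  "subtopology (product_topology (\<lambda>i. top_of_set (wedge (k i))) UNIV) (inv_limit k f) = top_of_set (inv_limit k f)"
proof -
  have "product_topology (\<lambda>i. top_of_set (wedge (k i))) UNIV = top_of_set (\<Pi>\<^sub>E i\<in>UNIV. wedge (k i))"
    by (simp add: subtopology_product_topology[symmetric] euclidean_product_topology)
  moreover have "(\<Pi>\<^sub>E i\<in>UNIV. wedge (k i)) \<inter> inv_limit k f = inv_limit k f"
    unfolding inv_limit_def by auto
  ultimately show ?thesis by (simp add: subtopology_subtopology)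
qed

lemma flow_space_in:
  assumes "flow_space X \<phi>" "x \<in> topspace X" shows "\<phi> t x \<in> topspace X"
proof -
  have "continuous_map (prod_topology euclideanreal X) X (\<lambda>(t, x). \<phi> t x)"
    using assms by (simp add: flow_space_def)
  from continuous_map_image_subset_topspace[OF this] show ?thesis using assms(2) by auto
qed

text \<open>Transporting the flow along the coordinate homeomorphism makes its i-th coordinate equal
  to \<open>p i\<close> along an orbit, so positivity of the projections becomes the positivity
  required of a level flow.\<close>

lemma expansion_level_flow:
  assumes X: "flow_space X \<phi>" and ex: "expansion X \<phi> x0 k f p"
    and P: "homeomorphic_maps X (top_of_set (inv_limit k f)) (\<lambda>x i. p i x) P'"
  shows "level_flow k f (\<lambda>t s i. p i (\<phi> t (P' s)))"
proof -
  let ?K = "inv_limit k f" and ?P = "\<lambda>x i. p i x"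
  have cP: "continuous_map X (top_of_set ?K) ?P" and cP': "continuous_map (top_of_set ?K) X P'"
    and inv: "\<And>x. x \<in> topspace X \<Longrightarrow> P' (?P x) = x" "\<And>s. s \<in> ?K \<Longrightarrow> ?P (P' s) = s"
    using P by (auto simp: homeomorphic_maps_def)
  have inK: "?P x \<in> ?K" if "x \<in> topspace X" for x
    using continuous_map_image_subset_topspace[OF cP] that by auto
  have inX: "P' s \<in> topspace X" if "s \<in> ?K" for s
    using continuous_map_image_subset_topspace[OF cP'] that by auto
  have cflow: "continuous_map (prod_topology euclideanreal X) X (\<lambda>(t, x). \<phi> t x)"
    and flow0: "\<And>x. x \<in> topspace X \<Longrightarrow> \<phi> 0 x = x"
    and flow_add: "\<And>s t x. x \<in> topspace X \<Longrightarrow> \<phi> (s + t) x = \<phi> s (\<phi> t x)"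
    using X by (auto simp: flow_space_def)
  show ?thesis
  proof unfold_locales
    have "compact_space (top_of_set ?K)"
      using X homeomorphic_compact_space[of X "top_of_set ?K"] P
      by (auto simp: flow_space_def homeomorphic_space_def)
    then have "compactin euclidean ?K" by (simp add: compactin_subspace)
    then show "compact ?K" by simp
    have "continuous_map (prod_topology euclideanreal (top_of_set ?K)) (prod_topology euclideanreal X) (\<lambda>z. (fst z, P' (snd z)))"
      by (intro continuous_map_pairedI continuous_map_fst continuous_map_compose[OF continuous_map_snd cP', unfolded comp_def])
    from continuous_map_compose[OF continuous_map_compose[OF this cflow] cP]
    have "continuous_map (prod_topology euclideanreal (top_of_set ?K)) (top_of_set ?K) (\<lambda>(t, s) i. p i (\<phi> t (P' s)))"
      by (simp add: comp_def case_prod_unfold)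
    moreover have "prod_topology euclideanreal (top_of_set ?K) = top_of_set (UNIV \<times> ?K)"
      by (simp add: prod_topology_subtopology)
    ultimately show "continuous_on (UNIV \<times> ?K) (\<lambda>(t, s) i. p i (\<phi> t (P' s)))"
      by (simp add: continuous_map_in_subtopology)
  next
    fix s t t' assume s: "s \<in> ?K"
    show "(\<lambda>i. p i (\<phi> t (P' s))) \<in> ?K" using inK flow_space_in[OF X inX[OF s]] by simp
    show "(\<lambda>i. p i (\<phi> 0 (P' s))) = s" using flow0[OF inX[OF s]] inv(2)[OF s] by simp
    show "(\<lambda>i. p i (\<phi> (t + t') (P' s))) = (\<lambda>i. p i (\<phi> t (P' (\<lambda>i. p i (\<phi> t' (P' s))))))"
      using flow_add[OF inX[OF s]] inv(1)[OF flow_space_in[OF X inX[OF s]]] by simp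
    fix i show "positive_at (k i) (\<lambda>t. p i (\<phi> t (P' s))) t"
      using ex inX[OF s] by (simp add: expansion_def)
  qed (use ex in \<open>simp_all add: expansion_def\<close>)
qed

theorem theorem7p12:
  fixes X :: "'a topology" and \<phi> :: "real \<Rightarrow> 'a \<Rightarrow> 'a"
    and Y :: "'b topology" and \<psi> :: "real \<Rightarrow> 'b \<Rightarrow> 'b"
    and x0 :: 'a and y0 :: 'b and k :: "nat \<Rightarrow> nat"
    and f g :: "nat \<Rightarrow> complex \<Rightarrow> complex"
    and p :: "nat \<Rightarrow> 'a \<Rightarrow> complex" and q :: "nat \<Rightarrow> 'b \<Rightarrow> complex"
  assumes "flow_space X \<phi>" and "minimal_flow X \<phi>" and "aperiodic_flow X \<phi>"
    and "flow_space Y \<psi>" and "minimal_flow Y \<psi>" and "aperiodic_flow Y \<psi>"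
    and "expansion X \<phi> x0 k f p"
    and "expansion Y \<psi> y0 k g q"
    and "\<forall>i. \<exists>\<alpha>. pi1_conj_by (wedge (k i)) 0 (wedge (k (Suc i))) 0 \<alpha> (g i) (f i)"
  shows "flow_equivalent X \<phi> Y \<psi>"
proof -
  let ?F = "inv_limit k f" and ?G = "inv_limit k g"
  let ?P = "\<lambda>x i. p i x" and ?Q = "\<lambda>y i. q i y"
  have hP: "homeomorphic_map X (top_of_set ?F) ?P" and hQ: "homeomorphic_map Y (top_of_set ?G) ?Q"
    and x0: "x0 \<in> topspace X"
    using assms(7,8) by (simp_all add: expansion_def inv_limit_topology)
  obtain P' Q' where P: "homeomorphic_maps X (top_of_set ?F) ?P P'"
    and Q: "homeomorphic_maps Y (top_of_set ?G) ?Q Q'"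
    using hP hQ unfolding homeomorphic_map_maps by blast
  have PK: "?P x \<in> ?F" "P' (?P x) = x" if "x \<in> topspace X" for x
    using P homeomorphic_imp_surjective_map[OF hP] that by (auto simp: homeomorphic_maps_def)
  have QK: "?Q y \<in> ?G" "Q' (?Q y) = y" if "y \<in> topspace Y" for y
    using Q homeomorphic_imp_surjective_map[OF hQ] that by (auto simp: homeomorphic_maps_def)
  have hQ': "homeomorphic_map (top_of_set ?G) Y Q'"
    using Q homeomorphic_maps_sym homeomorphic_map_maps by blast
  have Q'Y: "Q' s \<in> topspace Y" if "s \<in> ?G" for s
    using homeomorphic_imp_surjective_map[OF hQ'] that by auto
  let ?\<phi> = "\<lambda>t s i. p i (\<phi> t (P' s))" and ?\<psi> = "\<lambda>t s i. q i (\<psi> t (Q' s))"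
  \<comment> \<open>Minimality of the second flow, carried over by a homeomorphism, which commutes
    with closures.\<close>
  have dense: "?G \<subseteq> closure (range (\<lambda>t. ?\<psi> t s))" if s: "s \<in> ?G" for s
  proof -
    have orb: "orbit \<psi> (Q' s) \<subseteq> topspace Y"
      using flow_space_in[OF assms(4) Q'Y[OF s]] by (auto simp: orbit_def)
    have "?G = ?Q ` (Y closure_of orbit \<psi> (Q' s))"
      using assms(5) Q'Y[OF s] homeomorphic_imp_surjective_map[OF hQ] by (simp add: minimal_flow_def)
    also have "\<dots> = top_of_set ?G closure_of (?Q ` orbit \<psi> (Q' s))"
      using homeomorphic_map_closure_of[OF hQ orb] by simp
    also have "?Q ` orbit \<psi> (Q' s) = range (\<lambda>t. ?\<psi> t s)" by (auto simp: orbit_def image_image)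
    also have "top_of_set ?G closure_of (range (\<lambda>t. ?\<psi> t s)) \<subseteq> closure (range (\<lambda>t. ?\<psi> t s))"
      using closure_mono[of "?G \<inter> range (\<lambda>t. ?\<psi> t s)" "range (\<lambda>t. ?\<psi> t s)"]
      by (auto simp: closure_of_subtopology)
    finally show ?thesis .
  qed
  obtain h where h: "homeomorphic_map (top_of_set ?F) (top_of_set ?G) h"
    and orb: "\<forall>x\<in>?F. \<exists>\<sigma>. continuous_on UNIV \<sigma> \<and> strict_mono \<sigma> \<and> surj \<sigma> \<and>
      (\<forall>t. h (?\<phi> t x) = ?\<psi> (\<sigma> t) (h x))"
    using conjugate_level_flows_equivalent[OF expansion_level_flow[OF assms(1,7) P]
        expansion_level_flow[OF assms(4,8) Q] _ _ dense] assms(9) PK(1)[OF x0] by blast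
  have hG: "h s \<in> ?G" if "s \<in> ?F" for s
    using homeomorphic_imp_surjective_map[OF h] that by auto
  define H where "H x = Q' (h (?P x))" for x
  have "homeomorphic_map X Y H"
    using homeomorphic_map_compose[OF homeomorphic_map_compose[OF hP h] hQ'] by (simp add: H_def[abs_def] comp_def)
  moreover have "\<exists>\<tau>. continuous_on UNIV \<tau> \<and> strict_mono \<tau> \<and> surj \<tau> \<and> (\<forall>t. H (\<phi> t x) = \<psi> (\<tau> t) (H x))"
    if x: "x \<in> topspace X" for x
  proof -
    obtain \<sigma> where \<sigma>: "continuous_on UNIV \<sigma>" "strict_mono \<sigma>" "surj \<sigma>"
      "\<And>t. h (?\<phi> t (?P x)) = ?\<psi> (\<sigma> t) (h (?P x))" using orb PK(1)[OF x] by blast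
    have "H (\<phi> t x) = \<psi> (\<sigma> t) (H x)" for t
      using \<sigma>(4)[of t] QK(2)[OF flow_space_in[OF assms(4) Q'Y[OF hG[OF PK(1)[OF x]]]], of "\<sigma> t"]
      by (simp add: H_def PK(2)[OF x])
    then show ?thesis using \<sigma> by blast
  qed
  \<comment> \<open>Surjectivity of the time change turns inclusion of orbits into equality.\<close>
  moreover have "H ` orbit \<phi> x = orbit \<psi> (H x)"
    if "surj \<tau>" "\<forall>t. H (\<phi> t x) = \<psi> (\<tau> t) (H x)" for \<tau> x
  proof -
    have "H ` orbit \<phi> x = (\<lambda>t. \<psi> t (H x)) ` range \<tau>" using that(2) by (simp add: orbit_def image_image)
    then show ?thesis using that(1) by (simp add: orbit_def)
  qed
  ultimately show ?thesis unfolding flow_equivalent_def by metis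
qed

end
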